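(* Given an input-consistent DFA $\mathcal A=(Q,\Sigma,\delta,s,F)$ satisfying the standing assumptions below, a minimum-size chain partition of $<_{\mathcal A}$ can be computed in $O(mn)$ time, where $n=|Q|$ and $m$ is the number of transitions.
   Context: A DFA is $\mathcal A=(Q,\Sigma,\delta,s,F)$ with finite state set $Q$, finite totally ordered alphabet $\Sigma$, (partial) transition function $\delta$, initial state $s$, final states $F$; $m=|\{(u,v,a):\delta(u,a)=v\}|$. Standing assumptions: $s$ has no incoming transitions; every state is reachable from $s$; all transitions entering a given state carry the same label. $I_q=\{\alpha\in\Sigma^*:\delta(s,\alpha)=q\}$. Co-lex order on finite strings: $\epsilon<\alpha$ for nonempty $\alpha$; for $\alpha=\alpha'a$, $\beta=\beta'b$, $\alpha<\beta$ iff $a<b$, or $a=b$ and $\alpha'<\beta'$. The relation $<_{\mathcal A}$ on $Q$: $u<_{\mathcal A}v$ iff $\alpha<\beta$ for all $\alpha\in I_u$, $\beta\in I_v$ (it is a strict partial order). A chain partition of $<_{\mathcal A}$ is a partition of $Q$ into sets each of which is totally ordered by $<_{\mathcal A}$ (any two distinct elements are comparable); minimum-size means using the fewest sets. *)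

theory Defs
  imports Complex_Main "HOL-Library.Disjoint_Sets"
begin

section \<open>Automata\<close>

record ('q, 'a) dfa =
  states :: "'q set"
  alphabet :: "'a set"
  trans :: "'q \<Rightarrow> 'a \<Rightarrow> 'q option"
  init :: 'q
  finals :: "'q set"

definition wf_dfa :: "('q, 'a) dfa \<Rightarrow> bool" where
  "wf_dfa A \<longleftrightarrow>
     finite (states A) \<and> finite (alphabet A) \<and> init A \<in> states A \<and> finals A \<subseteq> states A \<and>
     (\<forall>u a v. trans A u a = Some v \<longrightarrow> u \<in> states A \<and> a \<in> alphabet A \<and> v \<in> states A)"

definition transitions :: "('q, 'a) dfa \<Rightarrow> ('q \<times> 'q \<times> 'a) set" where
  "transitions A = {(u, v, a). trans A u a = Some v}"

fun run :: "('q, 'a) dfa \<Rightarrow> 'q \<Rightarrow> 'a list \<Rightarrow> 'q option" where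
  "run A q [] = Some q"
| "run A q (a # \<alpha>) = Option.bind (trans A q a) (\<lambda>q'. run A q' \<alpha>)"

text \<open>The set $I_q$ of strings leading from the initial state to $q$.\<close>

definition strings_to :: "('q, 'a) dfa \<Rightarrow> 'q \<Rightarrow> 'a list set" where
  "strings_to A q = {\<alpha> \<in> lists (alphabet A). run A (init A) \<alpha> = Some q}"

definition input_consistent :: "('q, 'a) dfa \<Rightarrow> bool" where
  "input_consistent A \<longleftrightarrow>
     (\<forall>u u' v a b. trans A u a = Some v \<longrightarrow> trans A u' b = Some v \<longrightarrow> a = b)"

definition standing_assumptions :: "('q, 'a) dfa \<Rightarrow> bool" where
  "standing_assumptions A \<longleftrightarrow>
     wf_dfa A \<and>
     (\<forall>u a. trans A u a \<noteq> Some (init A)) \<and>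
     (\<forall>q \<in> states A. strings_to A q \<noteq> {}) \<and>
     input_consistent A"

inductive colex_less :: "'a::linorder list \<Rightarrow> 'a list \<Rightarrow> bool" where
  "\<alpha> \<noteq> [] \<Longrightarrow> colex_less [] \<alpha>"
| "a < b \<Longrightarrow> colex_less (\<alpha> @ [a]) (\<beta> @ [b])"
| "colex_less \<alpha> \<beta> \<Longrightarrow> colex_less (\<alpha> @ [a]) (\<beta> @ [a])"

definition state_less :: "('q, 'a::linorder) dfa \<Rightarrow> 'q \<Rightarrow> 'q \<Rightarrow> bool" where
  "state_less A u v \<longleftrightarrow>
     u \<in> states A \<and> v \<in> states A \<and>
     (\<forall>\<alpha> \<in> strings_to A u. \<forall>\<beta> \<in> strings_to A v. colex_less \<alpha> \<beta>)"

definition chain_partition :: "('q, 'a::linorder) dfa \<Rightarrow> 'q set set \<Rightarrow> bool" where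
  "chain_partition A \<P> \<longleftrightarrow>
     partition_on (states A) \<P> \<and>
     (\<forall>C \<in> \<P>. \<forall>u \<in> C. \<forall>v \<in> C. u \<noteq> v \<longrightarrow> state_less A u v \<or> state_less A v u)"

definition min_chain_partition :: "('q, 'a::linorder) dfa \<Rightarrow> 'q set set \<Rightarrow> bool" where
  "min_chain_partition A \<P> \<longleftrightarrow>
     chain_partition A \<P> \<and> (\<forall>\<P>'. chain_partition A \<P>' \<longrightarrow> card \<P> \<le> card \<P>')"


section \<open>A word RAM with unit-cost operations\<close>

text \<open>
  Programs are structured commands over finitely many named registers and one random-access
  memory of words. A word of size \<open>w\<close> holds a natural number below \<open>2 ^ w\<close>; an execution in which
  some intermediate value is not a word has no derivation. Every node of an expression or of a
  test, every assignment and every evaluation of a branch or loop condition costs one time unit.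
\<close>

record machine =
  regs :: "string \<Rightarrow> nat"
  mem :: "nat \<Rightarrow> nat"

datatype exp =
    Const nat
  | Reg string
  | Load exp
  | Add exp exp
  | Sub exp exp
  | Mul exp exp

datatype test =
    Less exp exp
  | Equal exp exp
  | Neg test
  | And test test

datatype com =
    Skip
  | Assign string exp
  | Store exp exp
  | Seq com com
  | If test com com
  | While test com

text \<open>Subtraction is truncated at zero.\<close>

primrec val :: "machine \<Rightarrow> exp \<Rightarrow> nat" where
  "val \<sigma> (Const x) = x"
| "val \<sigma> (Reg r) = regs \<sigma> r"
| "val \<sigma> (Load e) = mem \<sigma> (val \<sigma> e)"
| "val \<sigma> (Add e f) = val \<sigma> e + val \<sigma> f"
| "val \<sigma> (Sub e f) = val \<sigma> e - val \<sigma> f"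
| "val \<sigma> (Mul e f) = val \<sigma> e * val \<sigma> f"

primrec fits :: "nat \<Rightarrow> machine \<Rightarrow> exp \<Rightarrow> bool" where
  "fits w \<sigma> (Const x) \<longleftrightarrow> x < 2 ^ w"
| "fits w \<sigma> (Reg r) \<longleftrightarrow> regs \<sigma> r < 2 ^ w"
| "fits w \<sigma> (Load e) \<longleftrightarrow> fits w \<sigma> e \<and> mem \<sigma> (val \<sigma> e) < 2 ^ w"
| "fits w \<sigma> (Add e f) \<longleftrightarrow> fits w \<sigma> e \<and> fits w \<sigma> f \<and> val \<sigma> e + val \<sigma> f < 2 ^ w"
| "fits w \<sigma> (Sub e f) \<longleftrightarrow> fits w \<sigma> e \<and> fits w \<sigma> f"
| "fits w \<sigma> (Mul e f) \<longleftrightarrow> fits w \<sigma> e \<and> fits w \<sigma> f \<and> val \<sigma> e * val \<sigma> f < 2 ^ w"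

primrec exp_cost :: "exp \<Rightarrow> nat" where
  "exp_cost (Const x) = 1"
| "exp_cost (Reg r) = 1"
| "exp_cost (Load e) = 1 + exp_cost e"
| "exp_cost (Add e f) = 1 + exp_cost e + exp_cost f"
| "exp_cost (Sub e f) = 1 + exp_cost e + exp_cost f"
| "exp_cost (Mul e f) = 1 + exp_cost e + exp_cost f"

primrec holds :: "machine \<Rightarrow> test \<Rightarrow> bool" where
  "holds \<sigma> (Less e f) \<longleftrightarrow> val \<sigma> e < val \<sigma> f"
| "holds \<sigma> (Equal e f) \<longleftrightarrow> val \<sigma> e = val \<sigma> f"
| "holds \<sigma> (Neg b) \<longleftrightarrow> \<not> holds \<sigma> b"
| "holds \<sigma> (And b b') \<longleftrightarrow> holds \<sigma> b \<and> holds \<sigma> b'"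

primrec test_fits :: "nat \<Rightarrow> machine \<Rightarrow> test \<Rightarrow> bool" where
  "test_fits w \<sigma> (Less e f) \<longleftrightarrow> fits w \<sigma> e \<and> fits w \<sigma> f"
| "test_fits w \<sigma> (Equal e f) \<longleftrightarrow> fits w \<sigma> e \<and> fits w \<sigma> f"
| "test_fits w \<sigma> (Neg b) \<longleftrightarrow> test_fits w \<sigma> b"
| "test_fits w \<sigma> (And b b') \<longleftrightarrow> test_fits w \<sigma> b \<and> test_fits w \<sigma> b'"

primrec test_cost :: "test \<Rightarrow> nat" where
  "test_cost (Less e f) = 1 + exp_cost e + exp_cost f"
| "test_cost (Equal e f) = 1 + exp_cost e + exp_cost f"
| "test_cost (Neg b) = 1 + test_cost b"
| "test_cost (And b b') = 1 + test_cost b + test_cost b'"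

text \<open>\<open>exec w c \<sigma> t \<tau>\<close>: with word size \<open>w\<close>, command \<open>c\<close> started in \<open>\<sigma>\<close> halts in \<open>\<tau>\<close> after time \<open>t\<close>.\<close>

inductive exec :: "nat \<Rightarrow> com \<Rightarrow> machine \<Rightarrow> nat \<Rightarrow> machine \<Rightarrow> bool" for w where
  Skip: "exec w Skip \<sigma> 1 \<sigma>"
| Assign: "fits w \<sigma> e \<Longrightarrow>
    exec w (Assign r e) \<sigma> (1 + exp_cost e) (\<sigma>\<lparr>regs := (regs \<sigma>)(r := val \<sigma> e)\<rparr>)"
| Store: "fits w \<sigma> e \<Longrightarrow> fits w \<sigma> f \<Longrightarrow>
    exec w (Store e f) \<sigma> (1 + exp_cost e + exp_cost f)
      (\<sigma>\<lparr>mem := (mem \<sigma>)(val \<sigma> e := val \<sigma> f)\<rparr>)"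
| Seq: "exec w c \<sigma> t \<sigma>' \<Longrightarrow> exec w c' \<sigma>' t' \<sigma>'' \<Longrightarrow> exec w (Seq c c') \<sigma> (t + t') \<sigma>''"
| IfTrue: "test_fits w \<sigma> b \<Longrightarrow> holds \<sigma> b \<Longrightarrow> exec w c \<sigma> t \<sigma>' \<Longrightarrow>
    exec w (If b c c') \<sigma> (1 + test_cost b + t) \<sigma>'"
| IfFalse: "test_fits w \<sigma> b \<Longrightarrow> \<not> holds \<sigma> b \<Longrightarrow> exec w c' \<sigma> t \<sigma>' \<Longrightarrow>
    exec w (If b c c') \<sigma> (1 + test_cost b + t) \<sigma>'"
| WhileFalse: "test_fits w \<sigma> b \<Longrightarrow> \<not> holds \<sigma> b \<Longrightarrow>
    exec w (While b c) \<sigma> (1 + test_cost b) \<sigma>"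
| WhileTrue: "test_fits w \<sigma> b \<Longrightarrow> holds \<sigma> b \<Longrightarrow> exec w c \<sigma> t \<sigma>' \<Longrightarrow>
    exec w (While b c) \<sigma>' t' \<sigma>'' \<Longrightarrow>
    exec w (While b c) \<sigma> (1 + test_cost b + t + t') \<sigma>''"

inductive_cases SkipE: "exec w Skip \<sigma> t \<tau>"
inductive_cases AssignE: "exec w (Assign r e) \<sigma> t \<tau>"
inductive_cases StoreE: "exec w (Store e f) \<sigma> t \<tau>"
inductive_cases SeqE: "exec w (Seq c c') \<sigma> t \<tau>"
inductive_cases IfE: "exec w (If b c c') \<sigma> t \<tau>"
inductive_cases WhileE: "exec w (While b c) \<sigma> t \<tau>"

lemma exec_deterministic:
  "exec w c \<sigma> t \<tau> \<Longrightarrow> exec w c \<sigma> t' \<tau>' \<Longrightarrow> t = t' \<and> \<tau> = \<tau>'"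
proof (induction arbitrary: t' \<tau>' rule: exec.induct)
  case (Skip \<sigma>)
  then show ?case by (auto elim: SkipE)
next
  case (Assign \<sigma> e r)
  from Assign.prems show ?case by (rule AssignE) simp
next
  case (Store \<sigma> e f)
  from Store.prems show ?case by (rule StoreE) simp
next
  case (Seq c \<sigma> t \<sigma>' c' u \<sigma>'')
  from Seq.prems obtain t1 t2 \<rho> where *:
    "t' = t1 + t2" "exec w c \<sigma> t1 \<rho>" "exec w c' \<rho> t2 \<tau>'" by (rule SeqE)
  from Seq.IH(1)[OF *(2)] have eq: "t = t1" "\<sigma>' = \<rho>" by simp_all
  from Seq.IH(2)[OF *(3)[folded eq(2)]] eq *(1) show ?case by simp
next
  case (IfTrue \<sigma> b c t \<sigma>' c')
  from IfTrue.prems obtain t1 where *: "t' = Suc (test_cost b + t1)" "exec w c \<sigma> t1 \<tau>'"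
    by (rule IfE) (use IfTrue.hyps in simp_all)
  from IfTrue.IH[OF *(2)] *(1) show ?case by simp
next
  case (IfFalse \<sigma> b c' t \<sigma>' c)
  from IfFalse.prems obtain t1 where *: "t' = Suc (test_cost b + t1)" "exec w c' \<sigma> t1 \<tau>'"
    by (rule IfE) (use IfFalse.hyps in simp_all)
  from IfFalse.IH[OF *(2)] *(1) show ?case by simp
next
  case (WhileFalse \<sigma> b c)
  from WhileFalse.prems show ?case
    by (rule WhileE) (use WhileFalse.hyps in simp_all)
next
  case (WhileTrue \<sigma> b c t \<sigma>' u \<sigma>'')
  from WhileTrue.prems obtain t1 t2 \<rho> where *:
    "t' = Suc (test_cost b + t1 + t2)" "exec w c \<sigma> t1 \<rho>" "exec w (While b c) \<rho> t2 \<tau>'"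
    by (rule WhileE) (use WhileTrue.hyps in simp_all)
  from WhileTrue.IH(1)[OF *(2)] have eq: "t = t1" "\<sigma>' = \<rho>" by simp_all
  from WhileTrue.IH(2)[OF *(3)[folded eq(2)]] eq *(1) show ?case by simp
qed

definition initial_machine :: "nat list \<Rightarrow> machine" where
  "initial_machine xs =
     \<lparr>regs = (\<lambda>_. 0), mem = (\<lambda>i. if i < length xs then xs ! i else 0)\<rparr>"


section \<open>Input and output conventions\<close>

text \<open>
  The states are numbered \<open>0, \<dots>, n - 1\<close> by \<open>\<nu>\<close> in an arbitrary way, the letters are mapped to
  words by an arbitrary order embedding \<open>\<kappa>\<close>, and \<open>ts\<close> lists the transitions in arbitrary order.
\<close>

definition presentation ::
  "nat \<Rightarrow> ('q, 'a::linorder) dfa \<Rightarrow> ('q \<Rightarrow> nat) \<Rightarrow> ('a \<Rightarrow> nat) \<Rightarrow> ('q \<times> 'q \<times> 'a) list \<Rightarrow> bool"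
where
  "presentation w A \<nu> \<kappa> ts \<longleftrightarrow>
     bij_betw \<nu> (states A) {..<card (states A)} \<and>
     strict_mono_on (alphabet A) \<kappa> \<and> \<kappa> ` alphabet A \<subseteq> {..<2 ^ w} \<and>
     distinct ts \<and> set ts = transitions A"

definition encode ::
  "('q, 'a) dfa \<Rightarrow> ('q \<Rightarrow> nat) \<Rightarrow> ('a \<Rightarrow> nat) \<Rightarrow> ('q \<times> 'q \<times> 'a) list \<Rightarrow> nat list"
where
  "encode A \<nu> \<kappa> ts =
     [card (states A), length ts, \<nu> (init A)] @
     concat (map (\<lambda>(u, v, a). [\<nu> u, \<nu> v, \<kappa> a]) ts) @
     map (\<lambda>i. if i \<in> \<nu> ` finals A then 1 else 0) [0..<card (states A)]"

text \<open>The output is a class label for every state, stored in the first \<open>n\<close> memory cells.\<close>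

definition decode :: "('q, 'a) dfa \<Rightarrow> ('q \<Rightarrow> nat) \<Rightarrow> machine \<Rightarrow> 'q set set" where
  "decode A \<nu> \<sigma> =
     (\<lambda>q. {q' \<in> states A. mem \<sigma> (\<nu> q') = mem \<sigma> (\<nu> q)}) ` states A"

end

theory Submission
  imports Defs
begin

text \<open>
  For states \<open>u\<close> and \<open>v\<close>, stripping the longest common suffix of two strings that lead to \<open>u\<close>
  and \<open>v\<close> shows that \<open>u < v\<close> fails iff \<open>(u, v)\<close> is reached by equally labelled steps from a pair
  \<open>(u', v')\<close> in which \<open>v'\<close> is initial or \<open>u'\<close> has the larger incoming letter. Moving the two components
  one after the other gives a graph with \<open>2n\<^sup>2\<close> vertices and at most \<open>2mn\<close> edges, so a breadth-first
  search decides all comparisons in time \<open>O(mn)\<close>.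

  The order has nested down-sets (it is an interval order). Processing the states by increasing size
  of their down-sets, a greedy algorithm appends a state to any chain whose top is below it. A new
  chain is opened only if the current tops together with the new state form an antichain, so the
  number of chains is minimal.
\<close>

section \<open>Total correctness with time bounds\<close>

definition words :: "nat \<Rightarrow> machine \<Rightarrow> bool" where
  "words w \<sigma> \<longleftrightarrow> (\<forall>r. regs \<sigma> r < 2 ^ w) \<and> (\<forall>a. mem \<sigma> a < 2 ^ w)"

text \<open>On machines all of whose cells are words, only constants and arithmetic can overflow.\<close>

primrec safe :: "nat \<Rightarrow> machine \<Rightarrow> exp \<Rightarrow> bool" where
  "safe w \<sigma> (Const x) \<longleftrightarrow> x < 2 ^ w"
| "safe w \<sigma> (Reg r) \<longleftrightarrow> True"
| "safe w \<sigma> (Load e) \<longleftrightarrow> safe w \<sigma> e"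
| "safe w \<sigma> (Add e f) \<longleftrightarrow> safe w \<sigma> e \<and> safe w \<sigma> f \<and> val \<sigma> e + val \<sigma> f < 2 ^ w"
| "safe w \<sigma> (Sub e f) \<longleftrightarrow> safe w \<sigma> e \<and> safe w \<sigma> f"
| "safe w \<sigma> (Mul e f) \<longleftrightarrow> safe w \<sigma> e \<and> safe w \<sigma> f \<and> val \<sigma> e * val \<sigma> f < 2 ^ w"

primrec test_safe :: "nat \<Rightarrow> machine \<Rightarrow> test \<Rightarrow> bool" where
  "test_safe w \<sigma> (Less e f) \<longleftrightarrow> safe w \<sigma> e \<and> safe w \<sigma> f"
| "test_safe w \<sigma> (Equal e f) \<longleftrightarrow> safe w \<sigma> e \<and> safe w \<sigma> f"
| "test_safe w \<sigma> (Neg b) \<longleftrightarrow> test_safe w \<sigma> b"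
| "test_safe w \<sigma> (And b b') \<longleftrightarrow> test_safe w \<sigma> b \<and> test_safe w \<sigma> b'"

lemma safe_iff_fits: "words w \<sigma> \<Longrightarrow> safe w \<sigma> e \<longleftrightarrow> fits w \<sigma> e"
  by (induction e) (auto simp: words_def)

lemma test_safe_iff_fits: "words w \<sigma> \<Longrightarrow> test_safe w \<sigma> b \<longleftrightarrow> test_fits w \<sigma> b"
  by (induction b) (auto simp: safe_iff_fits)

lemma val_less_if_fits: "fits w \<sigma> e \<Longrightarrow> val \<sigma> e < 2 ^ w"
  by (induction e) auto

lemma exec_words: "exec w c \<sigma> t \<tau> \<Longrightarrow> words w \<sigma> \<Longrightarrow> words w \<tau>"
  by (induction rule: exec.induct) (auto simp: words_def val_less_if_fits)

definition runs :: "nat \<Rightarrow> com \<Rightarrow> machine \<Rightarrow> (nat \<Rightarrow> machine \<Rightarrow> bool) \<Rightarrow> bool" where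
  "runs w c \<sigma> Q \<longleftrightarrow> (words w \<sigma> \<longrightarrow> (\<exists>t \<tau>. exec w c \<sigma> t \<tau> \<and> Q t \<tau>))"

lemma runs_Skip: "Q 1 \<sigma> \<Longrightarrow> runs w Skip \<sigma> Q"
  unfolding runs_def using exec.Skip by blast

lemma runs_Assign:
  "safe w \<sigma> e \<Longrightarrow> Q (1 + exp_cost e) (\<sigma>\<lparr>regs := (regs \<sigma>)(r := val \<sigma> e)\<rparr>) \<Longrightarrow>
   runs w (Assign r e) \<sigma> Q"
  unfolding runs_def by (metis exec.Assign safe_iff_fits)

lemma runs_Store:
  "safe w \<sigma> e \<Longrightarrow> safe w \<sigma> f \<Longrightarrow>
   Q (1 + exp_cost e + exp_cost f) (\<sigma>\<lparr>mem := (mem \<sigma>)(val \<sigma> e := val \<sigma> f)\<rparr>) \<Longrightarrow>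
   runs w (Store e f) \<sigma> Q"
  unfolding runs_def by (metis exec.Store safe_iff_fits)

lemma runs_Seq:
  assumes "runs w c \<sigma> (\<lambda>t \<tau>. runs w c' \<tau> (\<lambda>t'. Q (t + t')))"
  shows "runs w (Seq c c') \<sigma> Q"
  using assms unfolding runs_def by (meson exec.Seq exec_words)

lemma runs_If:
  assumes "test_safe w \<sigma> b"
    and "holds \<sigma> b \<Longrightarrow> runs w c \<sigma> (\<lambda>t. Q (1 + test_cost b + t))"
    and "\<not> holds \<sigma> b \<Longrightarrow> runs w c' \<sigma> (\<lambda>t. Q (1 + test_cost b + t))"
  shows "runs w (If b c c') \<sigma> Q"
proof (cases "holds \<sigma> b")
  case True
  with assms show ?thesis unfolding runs_def by (meson exec.IfTrue test_safe_iff_fits)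
next
  case False
  with assms show ?thesis unfolding runs_def by (meson exec.IfFalse test_safe_iff_fits)
qed

lemma runs_mono:
  assumes "runs w c \<sigma> Q" "\<And>t \<tau>. Q t \<tau> \<Longrightarrow> Q' t \<tau>"
  shows "runs w c \<sigma> Q'"
  using assms unfolding runs_def by blast

text \<open>The ghost value \<open>g\<close> carries the logical state of the loop; its potential bounds the remaining time,
  which also gives termination.\<close>

lemma runs_While:
  fixes \<Phi> :: "'g \<Rightarrow> nat"
  assumes inv: "I g \<sigma>"
    and safe: "\<And>g \<sigma>. I g \<sigma> \<Longrightarrow> test_safe w \<sigma> b"
    and step: "\<And>g \<sigma>. I g \<sigma> \<Longrightarrow> holds \<sigma> b \<Longrightarrow>
      runs w c \<sigma> (\<lambda>t \<tau>. \<exists>g'. I g' \<tau> \<and> t + 1 + test_cost b + \<Phi> g' \<le> \<Phi> g)"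
    and post: "\<And>g' \<sigma> t. I g' \<sigma> \<Longrightarrow> \<not> holds \<sigma> b \<Longrightarrow> t + \<Phi> g' \<le> \<Phi> g + 1 + test_cost b \<Longrightarrow> Q t \<sigma>"
  shows "runs w (While b c) \<sigma> Q"
proof -
  have "words w \<sigma> \<Longrightarrow> \<exists>t \<tau> g'. exec w (While b c) \<sigma> t \<tau> \<and> I g' \<tau> \<and> \<not> holds \<tau> b \<and>
    t + \<Phi> g' \<le> \<Phi> g + 1 + test_cost b"
    using inv
  proof (induction "\<Phi> g" arbitrary: g \<sigma> rule: less_induct)
    case less
    show ?case
    proof (cases "holds \<sigma> b")
      case True
      from step[OF less.prems(2) True] less.prems(1) obtain t \<tau> g' where
        *: "exec w c \<sigma> t \<tau>" "I g' \<tau>" "t + 1 + test_cost b + \<Phi> g' \<le> \<Phi> g"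
        unfolding runs_def by blast
      then have "\<Phi> g' < \<Phi> g" by simp
      from less.hyps[OF this exec_words[OF *(1) less.prems(1)] *(2)] obtain t' \<tau>' g'' where
        **: "exec w (While b c) \<tau> t' \<tau>'" "I g'' \<tau>'" "\<not> holds \<tau>' b"
          "t' + \<Phi> g'' \<le> \<Phi> g' + 1 + test_cost b" by blast
      have "test_fits w \<sigma> b"
        using safe[OF less.prems(2)] less.prems(1) by (simp add: test_safe_iff_fits)
      from exec.WhileTrue[OF this True *(1) **(1)] **(2-4) *(3) show ?thesis
        by (intro exI[of _ "1 + test_cost b + t + t'"] exI[of _ \<tau>'] exI[of _ g'']) simp
    next
      case False
      have "test_fits w \<sigma> b"
        using safe[OF less.prems(2)] less.prems(1) by (simp add: test_safe_iff_fits)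
      from exec.WhileFalse[OF this False] False less.prems(2) show ?thesis
        by (intro exI[of _ "1 + test_cost b"] exI[of _ \<sigma>] exI[of _ g]) simp
    qed
  qed
  with post show ?thesis unfolding runs_def by blast
qed

section \<open>Memory layout\<close>

definition arr :: "nat \<Rightarrow> exp \<Rightarrow> exp" where
  "arr j e = Load (Add (Add (Reg ''B'') (Const j)) (Mul (Const 16) e))"

definition sto :: "nat \<Rightarrow> exp \<Rightarrow> exp \<Rightarrow> com" where
  "sto j e f = Store (Add (Add (Reg ''B'') (Const j)) (Mul (Const 16) e)) f"

definition idx :: "exp \<Rightarrow> exp \<Rightarrow> exp \<Rightarrow> exp" where
  "idx t x y = Add (Mul (Add (Mul t (Reg ''n'')) x) (Reg ''n'')) y"

lemma cost_arr [simp]: "exp_cost (arr j e) = exp_cost e + 7"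
  by (simp add: arr_def)

lemma cost_idx [simp]: "exp_cost (idx t x y) = exp_cost t + exp_cost x + exp_cost y + 6"
  by (simp add: idx_def)

locale instance_layout =
  fixes w n m s :: nat and inp :: "nat \<Rightarrow> nat"
  assumes s_less: "s < n"
    and room: "100 * (n + m + 2)\<^sup>2 \<le> 2 ^ w"
    and src_less: "e < m \<Longrightarrow> inp (3 + 3 * e) < n"
    and dst_less: "e < m \<Longrightarrow> inp (4 + 3 * e) < n"
    and dst_not_init: "e < m \<Longrightarrow> inp (4 + 3 * e) \<noteq> s"
    and lbl_dst: "e < m \<Longrightarrow> f < m \<Longrightarrow> inp (4 + 3 * e) = inp (4 + 3 * f) \<Longrightarrow>
      inp (5 + 3 * e) = inp (5 + 3 * f)"
begin

definition src :: "nat \<Rightarrow> nat" where "src e = inp (3 + 3 * e)"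
definition dst :: "nat \<Rightarrow> nat" where "dst e = inp (4 + 3 * e)"
definition lbl :: "nat \<Rightarrow> nat" where "lbl e = inp (5 + 3 * e)"

definition base :: nat where "base = 3 + 3 * m + n"
definition limit :: nat where "limit = 2 * (n * n) + n + m + 2"

lemma base_limit: "base + 16 * limit + 16 < 2 ^ w"
proof -
  have "100 * (n + m + 2)\<^sup>2 = 100 * (n*n) + 100 * (m*m) + 400 + 200 * (n*m) + 400*n + 400*m"
    by (simp add: power2_eq_square algebra_simps)
  then have "base + 16 * limit + 16 < 100 * (n + m + 2)\<^sup>2"
    by (simp add: base_def limit_def)
  with room show ?thesis by linarith
qed

lemma limits: "n < limit" "m < limit" "2 * (n * n) < limit" "n \<le> base" "3 * m + 3 \<le> base"
  by (auto simp: base_def limit_def)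

lemma limit_less: "x < limit \<Longrightarrow> x < 2 ^ w" "x \<le> limit \<Longrightarrow> x + 1 < 2 ^ w"
  using base_limit by linarith+

lemma n_pos: "0 < n" using s_less by simp

text \<open>Cells from \<open>base\<close> on hold 16 interleaved unbounded arrays, so that arrays never overlap.\<close>

definition lay :: "(nat \<Rightarrow> nat \<Rightarrow> nat) \<Rightarrow> nat \<Rightarrow> nat" where
  "lay F a = (if a < base then inp a else F ((a - base) mod 16) ((a - base) div 16))"

definition mk :: "(string \<Rightarrow> nat) \<Rightarrow> (nat \<Rightarrow> nat \<Rightarrow> nat) \<Rightarrow> machine" where
  "mk \<rho> F = \<lparr>regs = \<rho>(''n'' := n, ''m'' := m, ''s'' := s, ''B'' := base), mem = lay F\<rparr>"

lemma regs_mk: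
  "regs (mk \<rho> F) ''n'' = n" "regs (mk \<rho> F) ''m'' = m" "regs (mk \<rho> F) ''s'' = s"
  "regs (mk \<rho> F) ''B'' = base"
  "r \<notin> {''n'', ''m'', ''s'', ''B''} \<Longrightarrow> regs (mk \<rho> F) r = \<rho> r"
  by (auto simp: mk_def)

lemma lay_array: "j < 16 \<Longrightarrow> lay F (base + j + 16 * i) = F j i"
  by (simp add: lay_def)

lemma mem_mk: "mem (mk \<rho> F) = lay F" by (simp add: mk_def)

lemma lay_edge:
  assumes "e < m"
  shows "lay F (3 + 3 * e) = src e" "lay F (4 + 3 * e) = dst e" "lay F (5 + 3 * e) = lbl e"
  using assms by (auto simp: lay_def src_def dst_def lbl_def base_def)

lemma lay_upd:
  assumes "j < 16"
  shows "(lay F)(base + j + 16 * i := x) = lay (F(j := (F j)(i := x)))"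
proof
  fix a
  have "a = base + j + 16 * i \<longleftrightarrow> \<not> a < base \<and> (a - base) mod 16 = j \<and> (a - base) div 16 = i"
    using assms by (auto simp: add.assoc)
  then show "((lay F)(base + j + 16 * i := x)) a = lay (F(j := (F j)(i := x))) a"
    by (auto simp: lay_def)
qed

lemma val_arr [simp]: "j < 16 \<Longrightarrow> val (mk \<rho> F) (arr j e) = F j (val (mk \<rho> F) e)"
  by (simp add: arr_def regs_mk) (simp add: mk_def lay_array)

lemma array_address:
  assumes "j < 16" "safe w (mk \<rho> F) e" "val (mk \<rho> F) e < limit"
  shows "safe w (mk \<rho> F) (Add (Add (Reg ''B'') (Const j)) (Mul (Const 16) e))"
proof -
  have "base + j + 16 * val (mk \<rho> F) e < 2 ^ w" "(16::nat) < 2 ^ w"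
    using assms base_limit by linarith+
  then show ?thesis using assms by (auto simp: regs_mk)
qed

lemma safe_arr:
  "j < 16 \<Longrightarrow> safe w (mk \<rho> F) e \<Longrightarrow> val (mk \<rho> F) e < limit \<Longrightarrow> safe w (mk \<rho> F) (arr j e)"
  unfolding arr_def using array_address by simp

lemma runs_sto:
  assumes "j < 16" "safe w (mk \<rho> F) e" "safe w (mk \<rho> F) f" "val (mk \<rho> F) e < limit"
    and "Q (7 + exp_cost e + exp_cost f) (mk \<rho> (F(j := (F j)(val (mk \<rho> F) e := val (mk \<rho> F) f))))"
  shows "runs w (sto j e f) (mk \<rho> F) Q"
  unfolding sto_def
proof (rule runs_Store)
  let ?a = "Add (Add (Reg ''B'') (Const j)) (Mul (Const 16) e)"
  have "val (mk \<rho> F) ?a = base + j + 16 * val (mk \<rho> F) e" by (simp add: regs_mk)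
  then have "(mk \<rho> F)\<lparr>mem := (mem (mk \<rho> F))(val (mk \<rho> F) ?a := val (mk \<rho> F) f)\<rparr> =
    mk \<rho> (F(j := (F j)(val (mk \<rho> F) e := val (mk \<rho> F) f)))"
    using lay_upd[OF assms(1)] by (simp add: mk_def)
  moreover have "1 + exp_cost ?a + exp_cost f = 7 + exp_cost e + exp_cost f" by simp
  ultimately show "Q (1 + exp_cost ?a + exp_cost f)
     ((mk \<rho> F)\<lparr>mem := (mem (mk \<rho> F))(val (mk \<rho> F) ?a := val (mk \<rho> F) f)\<rparr>)"
    using assms(5) by metis
qed (use assms array_address in simp_all)

lemma runs_assign:
  assumes "r \<notin> {''n'', ''m'', ''s'', ''B''}" "safe w (mk \<rho> F) e"
    and "Q (1 + exp_cost e) (mk (\<rho>(r := val (mk \<rho> F) e)) F)"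
  shows "runs w (Assign r e) (mk \<rho> F) Q"
proof (rule runs_Assign)
  have "(mk \<rho> F)\<lparr>regs := (regs (mk \<rho> F))(r := val (mk \<rho> F) e)\<rparr> = mk (\<rho>(r := val (mk \<rho> F) e)) F"
    using assms(1) by (auto simp: mk_def)
  then show "Q (1 + exp_cost e) ((mk \<rho> F)\<lparr>regs := (regs (mk \<rho> F))(r := val (mk \<rho> F) e)\<rparr>)"
    using assms(3) by simp
qed (use assms in simp)

lemma val_idx [simp]: "val (mk \<rho> F) (idx t x y) =
    (val (mk \<rho> F) t * n + val (mk \<rho> F) x) * n + val (mk \<rho> F) y"
  by (simp add: idx_def regs_mk)

lemma pair_less: "x < n \<Longrightarrow> y < n \<Longrightarrow> x * n + y < n * n"
proof -
  assume "x < n" "y < n"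
  then have "x * n + y < (x + 1) * n" by simp
  also have "\<dots> \<le> n * n" using \<open>x < n\<close> by (intro mult_le_mono1) simp
  finally show ?thesis .
qed

lemma idx_less: "t < 2 \<Longrightarrow> x < n \<Longrightarrow> y < n \<Longrightarrow> (t * n + x) * n + y < 2 * (n * n)"
proof -
  assume *: "t < 2" "x < n" "y < n"
  then have "t = 0 \<or> t = 1" by auto
  with * show ?thesis using pair_less[of x y] by (auto simp: algebra_simps)
qed

lemma pair_inj:
  "y < n \<Longrightarrow> y' < n \<Longrightarrow> x * n + y = x' * n + y' \<longleftrightarrow> x = x' \<and> y = y'" for x x' y y' :: nat
  by (metis add.commute add_right_cancel div_mult_self3 div_less gr_implies_not0 add_0)

lemma idx_inj:
  "x < n \<Longrightarrow> y < n \<Longrightarrow> x' < n \<Longrightarrow> y' < n \<Longrightarrow>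
   (t * n + x) * n + y = (t' * n + x') * n + y' \<longleftrightarrow> t = t' \<and> x = x' \<and> y = y'"
  by (metis pair_inj)

lemma safe_idx:
  assumes "safe w (mk \<rho> F) t" "safe w (mk \<rho> F) x" "safe w (mk \<rho> F) y"
    and "val (mk \<rho> F) t < 2" "val (mk \<rho> F) x < n" "val (mk \<rho> F) y < n"
  shows "safe w (mk \<rho> F) (idx t x y)"
proof -
  let ?t = "val (mk \<rho> F) t" and ?x = "val (mk \<rho> F) x" and ?y = "val (mk \<rho> F) y"
  have 1: "(?t * n + ?x) * n + ?y < 2 ^ w"
    using idx_less[OF assms(4-6)] limits base_limit by linarith
  moreover have "?t * n + ?x \<le> (?t * n + ?x) * n" using n_pos by simp
  ultimately have "?t * n + ?x < 2 ^ w" "?t * n < 2 ^ w" by linarith+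
  with 1 show ?thesis using assms by (auto simp: idx_def regs_mk)
qed

definition reaches ::
  "('g \<Rightarrow> (string \<Rightarrow> nat) \<Rightarrow> (nat \<Rightarrow> nat \<Rightarrow> nat) \<Rightarrow> bool) \<Rightarrow> ('g \<Rightarrow> nat) \<Rightarrow> nat \<Rightarrow>
   nat \<Rightarrow> machine \<Rightarrow> bool" where
  "reaches I \<Phi> T t \<tau> \<longleftrightarrow> (\<exists>g \<rho> F. \<tau> = mk \<rho> F \<and> I g \<rho> F \<and> t + \<Phi> g \<le> T)"

lemma reachesI: "I g \<rho> F \<Longrightarrow> t + \<Phi> g \<le> T \<Longrightarrow> reaches I \<Phi> T t (mk \<rho> F)"
  unfolding reaches_def by blast

lemma runs_while:
  fixes \<Phi> :: "'g \<Rightarrow> nat"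
  assumes inv: "I g \<rho> F"
    and safe: "\<And>g \<rho> F. I g \<rho> F \<Longrightarrow> test_safe w (mk \<rho> F) b"
    and step: "\<And>g \<rho> F. I g \<rho> F \<Longrightarrow> holds (mk \<rho> F) b \<Longrightarrow>
      runs w c (mk \<rho> F) (\<lambda>t. reaches I \<Phi> (\<Phi> g) (t + 1 + test_cost b))"
    and post: "\<And>g' \<rho> F t. I g' \<rho> F \<Longrightarrow> \<not> holds (mk \<rho> F) b \<Longrightarrow>
      t + \<Phi> g' \<le> \<Phi> g + 1 + test_cost b \<Longrightarrow> Q t (mk \<rho> F)"
  shows "runs w (While b c) (mk \<rho> F) Q"
proof (rule runs_While[where I = "\<lambda>g \<sigma>. \<exists>\<rho> F. \<sigma> = mk \<rho> F \<and> I g \<rho> F" and g = g and \<Phi> = \<Phi>])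
  show "runs w c \<sigma> (\<lambda>t \<tau>. \<exists>g'. (\<exists>\<rho> F. \<tau> = mk \<rho> F \<and> I g' \<rho> F) \<and>
      t + 1 + test_cost b + \<Phi> g' \<le> \<Phi> g)"
    if "\<exists>\<rho> F. \<sigma> = mk \<rho> F \<and> I g \<rho> F" "holds \<sigma> b" for g \<sigma>
  proof -
    from that obtain \<rho> F where *: "\<sigma> = mk \<rho> F" "I g \<rho> F" by blast
    show ?thesis unfolding *(1)
      by (rule runs_mono[OF step[OF *(2) that(2)[unfolded *(1)]]]) (unfold reaches_def, blast)
  qed
qed (use inv safe post in blast)+

lemmas runs_intros = runs_Skip runs_Seq runs_If runs_sto runs_assign

end

section \<open>Adjacency lists\<close>

text \<open>Arrays: 0 incoming letter, 1 first outgoing edge, 2 next edge with the same source, 3 marks of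
  the search, 4 to 6 components of the queue entries, 7 size of the down-set, 8 top of a chain,
  9 chain of a state. Edges are counted from 1 in the lists, with 0 as the end marker.\<close>

definition adjacency_com :: com where
  "adjacency_com = Seq (Assign ''e'' (Const 0))
     (While (Less (Reg ''e'') (Reg ''m''))
       (Seq (Assign ''u'' (Load (Add (Const 3) (Mul (Const 3) (Reg ''e'')))))
       (Seq (Assign ''v'' (Load (Add (Const 4) (Mul (Const 3) (Reg ''e'')))))
       (Seq (sto 0 (Reg ''v'') (Load (Add (Const 5) (Mul (Const 3) (Reg ''e'')))))
       (Seq (Assign ''e'' (Add (Reg ''e'') (Const 1)))
       (Seq (sto 2 (Reg ''e'') (arr 1 (Reg ''u'')))
            (sto 1 (Reg ''u'') (Reg ''e''))))))))"

context instance_layout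
begin

primrec last_edge :: "nat \<Rightarrow> nat \<Rightarrow> nat" where
  "last_edge 0 u = 0"
| "last_edge (Suc i) u = (if src i = u then Suc i else last_edge i u)"

definition lab :: "nat \<Rightarrow> nat \<Rightarrow> nat" where
  "lab i v = (if \<exists>e < i. dst e = v then lbl (SOME e. e < i \<and> dst e = v) else 0)"

lemma lab_edge: "e < i \<Longrightarrow> i \<le> m \<Longrightarrow> lab i (dst e) = lbl e"
proof -
  assume e: "e < i" "i \<le> m"
  let ?f = "SOME f. f < i \<and> dst f = dst e"
  have "?f < i \<and> dst ?f = dst e" by (rule someI[of _ e]) (use e in simp)
  with e have "lbl ?f = lbl e" unfolding lbl_def dst_def by (intro lbl_dst) auto
  with e show ?thesis by (auto simp: lab_def)
qed

lemma lab_Suc: "i < m \<Longrightarrow> lab (Suc i) = (lab i)(dst i := lbl i)"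
proof
  fix v assume i: "i < m"
  show "lab (Suc i) v = ((lab i)(dst i := lbl i)) v"
  proof (cases "\<exists>e < Suc i. dst e = v")
    case True
    then obtain e where e: "e < Suc i" "v = dst e" by auto
    with i have 1: "lab (Suc i) v = lbl e" using lab_edge by simp
    show ?thesis
    proof (cases "v = dst i")
      case True
      with i have "lab (Suc i) v = lbl i" using lab_edge[of i "Suc i"] by simp
      with True show ?thesis by simp
    next
      case False
      with e have "e < i" by (auto simp: less_Suc_eq)
      with i e have "lab i v = lbl e" using lab_edge by simp
      with False 1 show ?thesis by simp
    qed
  next
    case False
    then show ?thesis by (auto simp: lab_def less_Suc_eq)
  qed
qed

definition adjacent :: "nat \<Rightarrow> (nat \<Rightarrow> nat \<Rightarrow> nat) \<Rightarrow> bool" where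
  "adjacent i F \<longleftrightarrow> F 0 = lab i \<and> (\<forall>u. F 1 u = last_edge i u) \<and>
     (\<forall>e < i. F 2 (Suc e) = last_edge e (src e)) \<and> (\<forall>j \<ge> 3. \<forall>k. F j k = 0)"

lemma runs_adjacency:
  assumes F: "\<And>j k. F j k = 0"
    and post: "\<And>t \<rho>' F'. adjacent m F' \<Longrightarrow> t \<le> 100 * m + 100 \<Longrightarrow> Q t (mk \<rho>' F')"
  shows "runs w adjacency_com (mk \<rho> F) Q"
proof -
  define I where "I = (\<lambda>i \<rho>' F'. i \<le> m \<and> \<rho>' ''e'' = i \<and> adjacent i F')"
  show ?thesis unfolding adjacency_com_def
    apply (intro runs_intros)
      apply simp
     apply simp
    subgoal
    proof (rule runs_while[where I = I and g = 0 and \<Phi> = "\<lambda>i. 100 * (m - i)"], goal_cases)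
      case 1
      then show ?case using F by (auto simp: I_def adjacent_def lab_def)
    next
      case (2 g \<rho>' F')
      then show ?case by simp
    next
      case (3 i \<rho>' F')
      then have *: "i < m" "\<rho>' ''e'' = i" "adjacent i F'"
        by (auto simp: I_def regs_mk)
      have b: "4 + 3 * i < base" "5 + 3 * i < base" "3 + 3 * i < base" "dst i < limit" "src i < limit"
        "5 + 3 * i < 2 ^ w"
        using *(1) limits dst_less[of i] src_less[of i] base_limit by (auto simp: dst_def src_def)
      show ?case
        apply (intro runs_intros)
        apply (simp_all add: regs_mk mem_mk lay_edge safe_arr * b)
             apply (use base_limit limits *(1) in \<open>(intro conjI)?; linarith\<close>)+
        apply (rule reachesI[where g = "Suc i"])
        using * apply (auto simp: I_def adjacent_def lab_Suc less_Suc_eq)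
        done
    next
      case (4 g' \<rho>' F' t)
      then have "g' = m" by (simp add: I_def regs_mk)
      with 4 show ?case by (intro post) (auto simp: I_def)
    qed
    done
qed

end

section \<open>Search in the graph of pairs\<close>

definition pairs_com :: "com \<Rightarrow> com" where
  "pairs_com c = Seq (Assign ''u'' (Const 0)) (Seq (Assign ''v'' (Const 0))
     (While (Less (Reg ''u'') (Reg ''n''))
       (Seq c (Seq (Assign ''v'' (Add (Reg ''v'') (Const 1)))
         (If (Less (Reg ''v'') (Reg ''n'')) Skip
           (Seq (Assign ''v'' (Const 0)) (Assign ''u'' (Add (Reg ''u'') (Const 1)))))))))"

definition enqueue_com :: com where
  "enqueue_com =
    (let i = idx (Reg ''a'') (Reg ''b'') (Reg ''c'') in
     If (Equal (arr 3 i) (Const 0))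
       (Seq (sto 3 i (Const 1)) (Seq (sto 4 (Reg ''tl'') (Reg ''a''))
         (Seq (sto 5 (Reg ''tl'') (Reg ''b'')) (Seq (sto 6 (Reg ''tl'') (Reg ''c''))
           (Assign ''tl'' (Add (Reg ''tl'') (Const 1)))))))
       Skip)"

context instance_layout
begin

definition before :: "nat \<Rightarrow> nat \<Rightarrow> (nat \<times> nat) set" where
  "before u v = {(x, y). x < n \<and> y < n \<and> (x < u \<or> x = u \<and> y < v)}"

abbreviation pairs :: "(nat \<times> nat) set" where
  "pairs \<equiv> {..<n} \<times> {..<n}"

definition ends :: "(nat \<Rightarrow> (string \<Rightarrow> nat) \<Rightarrow> (nat \<Rightarrow> nat \<Rightarrow> nat) \<Rightarrow> bool) \<Rightarrow> nat \<Rightarrow> machine \<Rightarrow> bool" where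
  "ends P t \<tau> \<longleftrightarrow> (\<exists>\<rho> F. \<tau> = mk \<rho> F \<and> P t \<rho> F)"

lemma endsI: "P t \<rho> F \<Longrightarrow> ends P t (mk \<rho> F)"
  unfolding ends_def by blast

lemma runs_pairs:
  fixes T :: "nat \<times> nat \<Rightarrow> nat"
  assumes init: "I {} \<rho> F"
    and frame: "\<And>S \<rho> F r a. r \<in> {''u'', ''v''} \<Longrightarrow> I S \<rho> F \<Longrightarrow> I S (\<rho>(r := a)) F"
    and step: "\<And>u v \<rho> F. u < n \<Longrightarrow> v < n \<Longrightarrow> I (before u v) \<rho> F \<Longrightarrow> \<rho> ''u'' = u \<Longrightarrow> \<rho> ''v'' = v \<Longrightarrow>
      runs w c (mk \<rho> F) (ends (\<lambda>t \<rho>' F'. t \<le> T (u, v) \<and> \<rho>' ''u'' = u \<and> \<rho>' ''v'' = v \<and>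
        I (insert (u, v) (before u v)) \<rho>' F'))"
    and post: "\<And>\<rho> F t. I pairs \<rho> F \<Longrightarrow> t \<le> (\<Sum>p\<in>pairs. T p + 30) + 30 \<Longrightarrow> Q t (mk \<rho> F)"
  shows "runs w (pairs_com c) (mk \<rho> F) Q"
proof -
  define J where "J = (\<lambda>(u, v) \<rho> F. u \<le> n \<and> v < n \<and> (u = n \<longrightarrow> v = 0) \<and> \<rho> ''u'' = u \<and> \<rho> ''v'' = v \<and>
    I (before u v) \<rho> F)"
  define \<Phi> where "\<Phi> = (\<lambda>(u, v). \<Sum>p\<in>pairs - before u v. T p + 30)"
  have next1: "insert (u, v) (before u v) = before u (Suc v)" if "u < n" "v < n" for u v
    using that by (auto simp: before_def)
  have next2: "before u n = before (Suc u) 0" for u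
    by (auto simp: before_def)
  have bsub: "before u v \<subseteq> pairs" for u v by (auto simp: before_def)
  have pot: "T (u, v) + 30 + (\<Sum>p\<in>pairs - before u (Suc v). T p + 30) = (\<Sum>p\<in>pairs - before u v. T p + 30)"
    if "u < n" "v < n" for u v
  proof -
    have "pairs - before u v = insert (u, v) (pairs - before u (Suc v))" "(u, v) \<in> before u (Suc v)"
      using that by (auto simp: before_def)
    then show ?thesis by simp
  qed
  show ?thesis unfolding pairs_com_def
    apply (intro runs_intros; simp)
    subgoal
    proof (rule runs_while[where I = J and g = "(0, 0)" and \<Phi> = \<Phi>], goal_cases)
      case 1
      have "before 0 0 = {}" by (auto simp: before_def)
      then show ?case using init n_pos by (simp add: J_def frame)
    next
      case (2 g \<rho>' F')
      then show ?case by simp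
    next
      case (3 g \<rho>' F')
      obtain u v where g: "g = (u, v)" by force
      from 3 have *: "u < n" "v < n" "\<rho>' ''u'' = u" "\<rho>' ''v'' = v" "I (before u v) \<rho>' F'"
        by (auto simp: J_def g regs_mk)
      show ?case
      proof (rule runs_Seq, rule runs_mono[OF step[OF *(1,2,5,3,4)]], goal_cases)
        case (1 t \<tau>)
        then obtain \<rho>'' F'' where **: "\<tau> = mk \<rho>'' F''" "t \<le> T (u, v)" "\<rho>'' ''u'' = u" "\<rho>'' ''v'' = v"
          "I (insert (u, v) (before u v)) \<rho>'' F''" by (auto simp: ends_def)
        have fit: "Suc u < 2 ^ w" "Suc v < 2 ^ w" "Suc 0 < 2 ^ w"
          using base_limit limits(1) *(1,2) by linarith+
        show ?case unfolding **(1)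
          apply (intro runs_intros)
                  apply (simp_all add: regs_mk ** fit)
           apply (rule reachesI[where g = "(u, Suc v)"])
            apply (use ** * in \<open>simp add: J_def next1 frame less_imp_le\<close>)
           apply (use ** pot[OF *(1,2)] in \<open>simp add: g \<Phi>_def\<close>)
          apply (rule reachesI[where g = "(Suc u, 0)"])
          subgoal premises prems
          proof -
            have "Suc v = n" using prems * by simp
            then show ?thesis using ** * next1[of u v] next2[of u] n_pos
              by (auto simp: J_def frame)
          qed
          subgoal premises prems
          proof -
            have "Suc v = n" using prems * by simp
            then show ?thesis using ** pot[OF *(1,2)] next2[of u] by (simp add: g \<Phi>_def)
          qed
          done
      qed
    next
      case (4 g' \<rho>' F' t)
      obtain u v where g: "g' = (u, v)" by force
      with 4 have "u = n" "v = 0" by (auto simp: J_def regs_mk)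
      moreover have "before n 0 = pairs" "before 0 0 = {}" by (auto simp: before_def)
      ultimately show ?case using 4 by (intro post) (auto simp: J_def g \<Phi>_def)
    qed
    done
qed

definition nodes :: "(nat \<times> nat \<times> nat) set" where
  "nodes = {..<2} \<times> {..<n} \<times> {..<n}"

definition queue :: "(nat \<times> nat \<times> nat) list \<Rightarrow> (string \<Rightarrow> nat) \<Rightarrow> (nat \<Rightarrow> nat \<Rightarrow> nat) \<Rightarrow> bool" where
  "queue qs \<rho> F \<longleftrightarrow> \<rho> ''tl'' = length qs \<and> distinct qs \<and> set qs \<subseteq> nodes \<and>
     (\<forall>i < length qs. qs ! i = (F 4 i, F 5 i, F 6 i)) \<and>
     (\<forall>t < 2. \<forall>x < n. \<forall>y < n. F 3 ((t * n + x) * n + y) = (if (t, x, y) \<in> set qs then 1 else 0))"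

lemma finite_nodes [simp]: "finite nodes" by (simp add: nodes_def)

lemma card_nodes: "card nodes = 2 * (n * n)" by (simp add: nodes_def)

lemma queue_length: "queue qs \<rho> F \<Longrightarrow> length qs \<le> 2 * (n * n)"
  unfolding queue_def by (metis card_mono card_nodes distinct_card finite_nodes)

definition enq :: "'b list \<Rightarrow> 'b \<Rightarrow> 'b list" where
  "enq qs x = (if x \<in> set qs then qs else qs @ [x])"

lemma set_enq [simp]: "set (enq qs x) = insert x (set qs)"
  by (auto simp: enq_def)

lemma runs_enqueue:
  assumes q: "queue qs \<rho> F" and x: "(\<rho> ''a'', \<rho> ''b'', \<rho> ''c'') \<in> nodes"
    and post: "\<And>t F'. queue (enq qs (\<rho> ''a'', \<rho> ''b'', \<rho> ''c'')) (\<rho>(''tl'' := l)) F' \<Longrightarrow>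
      (\<And>j. j < 3 \<or> j > 6 \<Longrightarrow> F' j = F j) \<Longrightarrow> t \<le> 100 \<Longrightarrow> Q t (mk (\<rho>(''tl'' := l)) F')"
    and l: "l = length (enq qs (\<rho> ''a'', \<rho> ''b'', \<rho> ''c''))"
  shows "runs w enqueue_com (mk \<rho> F) Q"
proof -
  obtain a b c where r: "\<rho> ''a'' = a" "\<rho> ''b'' = b" "\<rho> ''c'' = c" by blast
  have b: "a < 2" "b < n" "c < n" using x by (auto simp: nodes_def r)
  let ?i = "(a * n + b) * n + c"
  have i: "?i < limit" using idx_less[OF b] limits by linarith
  have tl: "\<rho> ''tl'' = length qs" using q by (simp add: queue_def)
  have len: "length qs < limit" using queue_length[OF q] limits by linarith
  have F3: "F 3 ?i = (if (a, b, c) \<in> set qs then 1 else 0)" using q b by (simp add: queue_def)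
  show ?thesis unfolding enqueue_com_def Let_def
    apply (intro runs_intros)
                        apply (simp_all add: regs_mk safe_arr safe_idx r b i tl len limit_less)
       apply (use base_limit len in linarith)
      apply (use base_limit len in linarith)
    subgoal premises prems
    proof -
      have n: "(a, b, c) \<notin> set qs" using prems F3 by (auto split: if_splits)
      then have l': "l = Suc (length qs)" using l by (simp add: r enq_def)
      show ?thesis unfolding l'[symmetric]
      proof (rule post)
        have "queue (qs @ [(a, b, c)]) (\<rho>(''tl'' := l))
          (F(3 := (F 3)(?i := Suc 0), 4 := (F 4)(length qs := a), 5 := (F 5)(length qs := b),
             6 := (F 6)(length qs := c)))"
          using q b n l' by (auto simp: queue_def nodes_def nth_append idx_inj less_Suc_eq)
        then show "queue (enq qs (\<rho> ''a'', \<rho> ''b'', \<rho> ''c'')) (\<rho>(''tl'' := l))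
          (F(3 := (F 3)(?i := Suc 0), 4 := (F 4)(length qs := a), 5 := (F 5)(length qs := b),
             6 := (F 6)(length qs := c)))"
          using n by (simp add: enq_def r)
      qed auto
    qed
    subgoal premises prems
    proof -
      have n: "(a, b, c) \<in> set qs" using prems F3 by (auto split: if_splits)
      then have l': "\<rho> = \<rho>(''tl'' := l)" "l = length qs" using l tl by (simp_all add: r enq_def fun_upd_idem)
      show ?thesis
        by (subst l'(1), rule post) (use q n l' in \<open>simp_all add: enq_def r\<close>)
    qed
    done
qed

end

definition seed_com :: com where
  "seed_com = Seq (Assign ''tl'' (Const 0)) (pairs_com
     (If (Neg (And (Neg (Equal (Reg ''v'') (Reg ''s'')))
                   (Neg (Less (arr 0 (Reg ''v'')) (arr 0 (Reg ''u''))))))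
       (Seq (Assign ''a'' (Const 0)) (Seq (Assign ''b'' (Reg ''u'')) (Seq (Assign ''c'' (Reg ''v''))
          enqueue_com)))
       Skip))"

definition expand_com :: com where
  "expand_com = While (Less (Const 0) (Reg ''p''))
     (Seq (Assign ''a'' (Sub (Const 1) (Reg ''t'')))
     (Seq (Assign ''b'' (Load (Add (Const 1) (Mul (Const 3) (Reg ''p'')))))
     (Seq (Assign ''c'' (Reg ''x''))
     (Seq (If (Neg (And (Neg (Equal (Reg ''t'') (Const 0)))
                        (Neg (Equal (arr 0 (Reg ''b'')) (arr 0 (Reg ''c''))))))
            enqueue_com Skip)
          (Assign ''p'' (arr 2 (Reg ''p'')))))))"

definition search_com :: com where
  "search_com = Seq (Assign ''hd'' (Const 0))
     (While (Less (Reg ''hd'') (Reg ''tl''))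
       (Seq (Assign ''t'' (arr 4 (Reg ''hd'')))
       (Seq (Assign ''x'' (arr 5 (Reg ''hd'')))
       (Seq (Assign ''y'' (arr 6 (Reg ''hd'')))
       (Seq (Assign ''p'' (arr 1 (Reg ''y'')))
       (Seq expand_com
            (Assign ''hd'' (Add (Reg ''hd'') (Const 1)))))))))"

context instance_layout
begin

abbreviation label :: "nat \<Rightarrow> nat" where "label \<equiv> lab m"

definition seeds :: "(nat \<times> nat \<times> nat) set" where
  "seeds = {(0, u, v) | u v. u < n \<and> v < n \<and> (v = s \<or> label v < label u)}"

text \<open>A pair of predecessors is replaced by a pair of successors in two half steps, each of which
  moves one component along an edge and swaps; matching labels are checked in the second.\<close>

definition succs :: "nat \<Rightarrow> nat \<times> nat \<times> nat \<Rightarrow> (nat \<times> nat \<times> nat) set" where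
  "succs p = (\<lambda>(t, x, y). {(1 - t, dst e, x) | e. p \<le> e \<and> e < m \<and> src e = y \<and>
     (t = 0 \<or> label (dst e) = label x)})"

inductive_set marked :: "(nat \<times> nat \<times> nat) set" where
  seed: "q \<in> seeds \<Longrightarrow> q \<in> marked"
| step: "q \<in> marked \<Longrightarrow> q' \<in> succs 0 q \<Longrightarrow> q' \<in> marked"

definition static :: "(nat \<Rightarrow> nat \<Rightarrow> nat) \<Rightarrow> bool" where
  "static F \<longleftrightarrow> F 0 = label \<and> (\<forall>u. F 1 u = last_edge m u) \<and>
     (\<forall>e < m. F 2 (Suc e) = last_edge e (src e)) \<and> (\<forall>j \<ge> 7. \<forall>k. F j k = 0)"

lemma static_cong: "static F \<Longrightarrow> (\<And>j. j < 3 \<or> j > 6 \<Longrightarrow> F' j = F j) \<Longrightarrow> static F'"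
  by (simp add: static_def)

lemma static_if_adjacent: "adjacent m F \<Longrightarrow> static F"
  by (simp add: static_def adjacent_def)

lemma queue_frame: "r \<noteq> ''tl'' \<Longrightarrow> queue qs (\<rho>(r := a)) F \<longleftrightarrow> queue qs \<rho> F"
  by (simp add: queue_def)

lemma runs_seed:
  assumes F: "adjacent m F"
    and post: "\<And>t \<rho>' F' qs. static F' \<Longrightarrow> queue qs \<rho>' F' \<Longrightarrow> set qs = seeds \<Longrightarrow>
      t \<le> 300 * (n * n) + 100 \<Longrightarrow> Q t (mk \<rho>' F')"
  shows "runs w seed_com (mk \<rho> F) Q"
proof -
  define seed where "seed = (\<lambda>S. {(0::nat, u, v) | u v. (u, v) \<in> S \<and> (v = s \<or> label v < label u)})"
  define I where "I = (\<lambda>S \<rho> F. static F \<and> (\<exists>qs. queue qs \<rho> F \<and> set qs = seed S))"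
  show ?thesis unfolding seed_com_def
    apply (intro runs_intros)
      apply simp
     apply simp
    subgoal
    proof (rule runs_pairs[where I = I and T = "\<lambda>_. 150"], goal_cases)
      case 1
      have "queue [] (\<rho>(''tl'' := val (mk \<rho> F) (Const 0))) F"
        using F by (auto simp: queue_def adjacent_def)
      then show ?case using static_if_adjacent[OF F] by (auto simp: I_def seed_def)
    next
      case (2 S \<rho> F r a)
      then show ?case by (auto simp: I_def queue_frame)
    next
      case (3 u v \<rho>' F')
      then obtain qs where *: "static F'" "queue qs \<rho>' F'" "set qs = seed (before u v)"
        by (auto simp: I_def)
      have F0: "F' 0 = label" using *(1) by (simp add: static_def)
      have b: "u < limit" "v < limit" "u < n" "v < n" using 3 limits by linarith+
      let ?\<rho> = "\<rho>'(''a'' := 0, ''b'' := u, ''c'' := v)"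
      have n: "(?\<rho> ''a'', ?\<rho> ''b'', ?\<rho> ''c'') \<in> nodes" using b by (simp add: nodes_def)
      have q: "queue qs ?\<rho> F'" using *(2) by (simp add: queue_frame)
      have seed: "seed (insert (u, v) (before u v)) =
        (if v = s \<or> label v < label u then insert (0, u, v) (set qs) else set qs)"
        using *(3) by (auto simp: seed_def)
      show ?case
        apply (intro runs_intros)
               apply (simp_all add: regs_mk safe_arr 3 b F0)
         apply (rule runs_enqueue[OF q n _ refl])
         apply (rule endsI)
        subgoal for t F''
          using static_cong[OF *(1), of F''] seed 3 by (auto simp: I_def)
        apply (rule endsI)
        using 3 * seed by (auto simp: I_def)
    next
      case (4 \<rho>' F' t)
      have "seed pairs = seeds" by (auto simp: seed_def seeds_def)
      moreover have "(\<Sum>p\<in>pairs. 150 + 30) = 180 * (n * n)" by simp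
      ultimately show ?case using 4 by (auto simp: I_def intro!: post)
    qed
    done
qed

lemma last_edge_le: "last_edge i u \<le> i"
  by (induction i) auto

lemma last_edge_gap: "last_edge i u \<le> e \<Longrightarrow> e < i \<Longrightarrow> src e \<noteq> u"
  by (induction i) (auto simp: less_Suc_eq split: if_splits)

lemma last_edge_src: "last_edge i u = Suc e \<Longrightarrow> src e = u"
  by (induction i) (auto split: if_splits)

lemma runs_expand:
  assumes q: "queue qs \<rho> F" and F: "static F" and x: "(\<rho> ''t'', \<rho> ''x'', \<rho> ''y'') \<in> nodes"
    and p: "\<rho> ''p'' = last_edge m (\<rho> ''y'')"
    and post: "\<And>t \<rho>' F' qs'. queue (qs @ qs') \<rho>' F' \<Longrightarrow> static F' \<Longrightarrow>
      set (qs @ qs') = set qs \<union> succs 0 (\<rho> ''t'', \<rho> ''x'', \<rho> ''y'') \<Longrightarrow> \<rho>' ''hd'' = \<rho> ''hd'' \<Longrightarrow>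
      t \<le> 300 * card {e. e < m \<and> src e = \<rho> ''y''} + 100 \<Longrightarrow> Q t (mk \<rho>' F')"
  shows "runs w expand_com (mk \<rho> F) Q"
proof -
  obtain t x y where r: "\<rho> ''t'' = t" "\<rho> ''x'' = x" "\<rho> ''y'' = y" by blast
  have b: "t < 2" "x < n" "y < n" using x by (auto simp: nodes_def r)
  define I where "I = (\<lambda>p \<rho>' F'. \<exists>qs'. queue (qs @ qs') \<rho>' F' \<and> static F' \<and>
    set (qs @ qs') = set qs \<union> succs p (t, x, y) \<and> \<rho>' ''hd'' = \<rho> ''hd'' \<and>
    \<rho>' ''t'' = t \<and> \<rho>' ''x'' = x \<and> \<rho>' ''y'' = y \<and> \<rho>' ''p'' = p \<and> p \<le> m \<and> (\<forall>e. p = Suc e \<longrightarrow> src e = y))"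
  define deg where "deg = (\<lambda>p. card {e. e < p \<and> src e = y})"
  show ?thesis unfolding expand_com_def
  proof (rule runs_while[where I = I and g = "last_edge m y" and \<Phi> = "\<lambda>p. 300 * deg p"], goal_cases)
    case 1
    have "succs (last_edge m y) (t, x, y) = {}" using last_edge_gap by (auto simp: succs_def)
    then show ?case using q F p r last_edge_le last_edge_src
      by (auto simp: I_def intro!: exI[of _ "[]"])
  next
    case (2 g \<rho> F)
    then show ?case using base_limit by simp
  next
    case (3 p \<rho>' F')
    then obtain qs' where I: "queue (qs @ qs') \<rho>' F'" "static F'"
      "set (qs @ qs') = set qs \<union> succs p (t, x, y)" "\<rho>' ''hd'' = \<rho> ''hd''"
      "\<rho>' ''t'' = t" "\<rho>' ''x'' = x" "\<rho>' ''y'' = y" "\<rho>' ''p'' = p" "p \<le> m" "\<forall>e. p = Suc e \<longrightarrow> src e = y"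
      unfolding I_def by blast
    have "0 < p" using 3(2) I by (simp add: regs_mk)
    then obtain e where e: "p = Suc e" by (auto simp: gr0_conv_Suc)
    have em: "e < m" "src e = y" using I e by auto
    have F: "F' 0 = label" "F' 2 (Suc e) = last_edge e y" using I(2) em by (auto simp: static_def)
    have dl: "dst e < n" using dst_less em by (simp add: dst_def)
    have sm: "Suc e < limit" "3 + 3 * e < 2 ^ w" "4 + 3 * e < 2 ^ w" "3 < (2::nat) ^ w"
      "dst e < limit" "x < limit" "Suc 0 < 2 ^ w"
      using limits base_limit em b dl by linarith+
    let ?\<rho> = "\<rho>'(''a'' := Suc 0 - t, ''b'' := dst e, ''c'' := x)"
    let ?v = "(Suc 0 - t, dst e, x)"
    have n: "(?\<rho> ''a'', ?\<rho> ''b'', ?\<rho> ''c'') \<in> nodes" using b dl by (auto simp: nodes_def)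
    have q: "queue (qs @ qs') ?\<rho> F'" using I(1) by (simp add: queue_frame)
    let ?p = "last_edge e y"
    have *: "?p \<le> f \<and> f < m \<and> src f = y \<longleftrightarrow> (p \<le> f \<and> f < m \<and> src f = y) \<or> f = e" for f
      using last_edge_le[of e y] last_edge_gap[of e y f] em e by force
    have succ: "succs ?p (t, x, y) =
      (if t = 0 \<or> label (dst e) = label x then insert ?v (succs p (t, x, y)) else succs p (t, x, y))"
    proof -
      have "succs ?p (t, x, y) = {(1 - t, dst f, x) | f. (?p \<le> f \<and> f < m \<and> src f = y) \<and>
          (t = 0 \<or> label (dst f) = label x)}" by (auto simp: succs_def)
      also have "\<dots> = {(1 - t, dst f, x) | f. ((p \<le> f \<and> f < m \<and> src f = y) \<or> f = e) \<and>
          (t = 0 \<or> label (dst f) = label x)}" unfolding * ..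
      finally show ?thesis by (auto simp: succs_def)
    qed
    have deg: "deg p = Suc (deg ?p)"
    proof -
      have "f < p \<and> src f = y \<longleftrightarrow> f = e \<or> f < ?p \<and> src f = y" for f
        using last_edge_le[of e y] last_edge_gap[of e y f] em e by force
      then have "{f. f < p \<and> src f = y} = insert e {f. f < ?p \<and> src f = y}" by auto
      moreover have "e \<notin> {f. f < ?p \<and> src f = y}" using last_edge_le[of e y] by auto
      ultimately show ?thesis by (simp add: deg_def)
    qed
    have pm: "?p \<le> m" "\<forall>f. ?p = Suc f \<longrightarrow> src f = y"
      using last_edge_le[of e y] last_edge_src em by auto
    show ?case
      apply (intro runs_intros)
                   apply (simp_all add: regs_mk mem_mk safe_arr I e sm lay_edge em F)
       apply (rule runs_enqueue[OF q n _ refl])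
      subgoal premises prems for t' F''
      proof -
        obtain qs'' where qs'': "enq (qs @ qs') ?v = qs @ qs''"
          unfolding enq_def by (metis append_assoc)
        have st: "static F''" using static_cong[OF I(2) prems(3)] .
        then have "F'' 2 (Suc e) = last_edge e y" using em by (simp add: static_def)
        have "set (qs @ qs'') = set qs \<union> succs ?p (t, x, y)"
          unfolding qs''[symmetric] set_enq succ using prems(1) I(3) by auto
        moreover have "queue (qs @ qs'') (?\<rho>(''tl'' := length (qs @ qs''))) F''"
          using prems(2) by (simp add: qs'' queue_def)
        ultimately show ?thesis
          apply (intro runs_intros)
            apply (simp_all add: regs_mk safe_arr sm I e qs'' \<open>F'' 2 (Suc e) = last_edge e y\<close>)
          apply (rule reachesI[where g = ?p])
          subgoal
            unfolding I_def by (rule exI[of _ qs'']) (use st pm I in \<open>simp add: queue_def\<close>)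
          using deg prems(4) e by simp
      qed
      apply (rule reachesI[where g = ?p])
      subgoal premises prems
        unfolding I_def
        by (rule exI[of _ qs']) (use pm I succ prems in \<open>simp add: queue_frame\<close>)
      using deg e apply simp
      done
  next
    case (4 p \<rho>' F' t')
    then have "p = 0" by (auto simp: I_def regs_mk)
    have "deg (last_edge m y) \<le> card {e. e < m \<and> src e = y}"
      unfolding deg_def using last_edge_le[of m y] by (intro card_mono) auto
    with 4 \<open>p = 0\<close> show ?case by (auto simp: I_def r intro!: post)
  qed
qed

lemma sum_outdegree: "(\<Sum>y<n. card {e. e < m \<and> src e = y}) = m"
proof -
  have "(\<Sum>y<n. card {e. e < m \<and> src e = y}) = card (\<Union>y<n. {e. e < m \<and> src e = y})"
    by (rule card_UN_disjoint[symmetric]) auto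
  also have "(\<Union>y<n. {e. e < m \<and> src e = y}) = {..<m}"
    using src_less by (auto simp: src_def)
  finally show ?thesis by simp
qed

lemma runs_search:
  assumes q: "queue qs \<rho> F" "set qs = seeds" and F: "static F"
    and post: "\<And>t \<rho>' F' qs'. queue qs' \<rho>' F' \<Longrightarrow> static F' \<Longrightarrow> set qs' = marked \<Longrightarrow>
      t \<le> 800 * (n * n) + 600 * (n * m) + 100 \<Longrightarrow> Q t (mk \<rho>' F')"
  shows "runs w search_com (mk \<rho> F) Q"
proof -
  define cost where "cost = (\<lambda>(t::nat, x::nat, y). 300 * card {e. e < m \<and> src e = y} + 400)"
  define I where "I = (\<lambda>(i, qs) \<rho> F. queue qs \<rho> F \<and> static F \<and> \<rho> ''hd'' = i \<and> i \<le> length qs \<and>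
    seeds \<subseteq> set qs \<and> set qs \<subseteq> marked \<and> (\<forall>k < i. succs 0 (qs ! k) \<subseteq> set qs))"
  define \<Phi> where "\<Phi> = (\<lambda>(i, qs). sum cost (nodes - set (take i qs)))"
  have total: "sum cost nodes = 800 * (n * n) + 600 * (n * m)"
  proof -
    have "sum cost nodes = (\<Sum>t<2::nat. \<Sum>x<n. \<Sum>y<n. 300 * card {e. e < m \<and> src e = y} + 400)"
      unfolding nodes_def cost_def
      by (simp only: sum.cartesian_product)
    also have "\<dots> = 2 * n * (300 * (\<Sum>y<n. card {e. e < m \<and> src e = y}) + 400 * n)"
      by (simp add: sum.distrib sum_distrib_left)
    also have "\<dots> = 800 * (n * n) + 600 * (n * m)" unfolding sum_outdegree by (simp add: algebra_simps)
    finally show ?thesis .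
  qed
  show ?thesis unfolding search_com_def
    apply (intro runs_intros)
      apply simp
     apply simp
    subgoal
    proof (rule runs_while[where I = I and g = "(0, qs)" and \<Phi> = \<Phi>], goal_cases)
      case 1
      show ?case using q F by (auto simp: I_def queue_frame intro: marked.seed)
    next
      case (2 g \<rho> F)
      then show ?case by simp
    next
      case (3 g \<rho>' F')
      obtain i qs where g: "g = (i, qs)" by force
      from 3 have I: "queue qs \<rho>' F'" "static F'" "\<rho>' ''hd'' = i" "i < length qs" "\<rho>' ''tl'' = length qs"
        "seeds \<subseteq> set qs" "set qs \<subseteq> marked" "\<forall>k < i. succs 0 (qs ! k) \<subseteq> set qs"
        by (simp_all add: I_def g regs_mk) (simp_all add: queue_def)
      obtain t x y where v: "qs ! i = (t, x, y)" by (metis prod_cases3)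
      then have F: "F' 4 i = t" "F' 5 i = x" "F' 6 i = y" "F' (Suc 0) y = last_edge m y"
        using I by (auto simp: queue_def static_def)
      have vn: "(t, x, y) \<in> set qs" "(t, x, y) \<in> nodes"
        using nth_mem[OF I(4)] v I(1) by (auto simp: queue_def)
      then have b: "x < n" "y < n" by (auto simp: nodes_def)
      have sm: "i < limit" "y < limit" "Suc i < 2 ^ w" "Suc 0 < 2 ^ w"
        using queue_length[OF I(1)] I(4) b limits base_limit by linarith+
      let ?\<rho> = "\<rho>'(''t'' := t, ''x'' := x, ''y'' := y, ''p'' := last_edge m y)"
      have q: "queue qs ?\<rho> F'" using I(1) by (simp add: queue_frame)
      have n: "(?\<rho> ''t'', ?\<rho> ''x'', ?\<rho> ''y'') \<in> nodes" using vn by simp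
      have p: "?\<rho> ''p'' = last_edge m (?\<rho> ''y'')" by simp
      have pot: "cost (t, x, y) + \<Phi> (Suc i, qs @ qs') = \<Phi> (i, qs)" for qs'
      proof -
        have t: "take (Suc i) (qs @ qs') = take i qs @ [(t, x, y)]"
          using I(4) v by (simp add: take_Suc_conv_app_nth)
        have "distinct (take (Suc i) qs)" using I(1) by (simp add: queue_def)
        then have "(t, x, y) \<notin> set (take i qs)"
          using I(4) v by (simp add: take_Suc_conv_app_nth)
        then have "nodes - set (take i qs) = insert (t, x, y) (nodes - insert (t, x, y) (set (take i qs)))"
          using vn by auto
        then have "sum cost (nodes - set (take i qs)) =
          cost (t, x, y) + sum cost (nodes - insert (t, x, y) (set (take i qs)))"
          by (metis (no_types, lifting) DiffE finite_Diff finite_nodes insertI1 sum.insert)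
        moreover have "set (take (Suc i) (qs @ qs')) = insert (t, x, y) (set (take i qs))"
          unfolding t by simp
        ultimately show ?thesis unfolding \<Phi>_def by simp
      qed
      show ?case
        apply (intro runs_intros)
                  apply (simp_all add: regs_mk mem_mk safe_arr I sm F)
        apply (rule runs_expand[OF q I(2) n p])
        subgoal premises prems for t' \<rho>'' F'' qs'
        proof -
          have h: "\<rho>'' ''hd'' = i" using prems(4) I(3) by simp
          have nth: "k < Suc i \<Longrightarrow> (qs @ qs') ! k = qs ! k" for k using I(4) by (simp add: nth_append)
          have sub: "set (qs @ qs') \<subseteq> marked"
            unfolding prems(3) using I(7) vn by (auto intro: marked.step)
          have cl: "\<forall>k < Suc i. succs 0 ((qs @ qs') ! k) \<subseteq> set (qs @ qs')"
            unfolding prems(3) using I(8) v by (auto simp: nth less_Suc_eq simp del: set_append)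
          show ?thesis
            apply (intro runs_intros)
              apply (simp_all add: regs_mk h sm)
            apply (rule reachesI[where g = "(Suc i, qs @ qs')"])
            subgoal using prems sub cl I by (auto simp: I_def queue_frame)
            using pot[of qs'] prems(5) by (simp add: g cost_def)
        qed
        done
    next
      case (4 g' \<rho>' F' t)
      obtain i qs' where g: "g' = (i, qs')" by force
      from 4 have I: "queue qs' \<rho>' F'" "static F'" "i = length qs'"
        "seeds \<subseteq> set qs'" "set qs' \<subseteq> marked" "\<forall>k < i. succs 0 (qs' ! k) \<subseteq> set qs'"
        by (simp_all add: I_def g regs_mk) (simp add: queue_def)
      have "q \<in> set qs'" if "q \<in> marked" for q
        using that
      proof induction
        case (step q q')
        then show ?case using I(3,6) by (force simp: in_set_conv_nth)
      qed (use I in blast)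
      with I have "set qs' = marked" by blast
      with 4 I total show ?case by (intro post) (auto simp: \<Phi>_def)
    qed
    done
qed

end

section \<open>Greedy chain partition\<close>

locale nested_downsets =
  fixes V :: "nat set" and lt :: "nat \<Rightarrow> nat \<Rightarrow> bool"
  assumes finite_V: "finite V"
    and irrefl: "v \<in> V \<Longrightarrow> \<not> lt v v"
    and trans: "u \<in> V \<Longrightarrow> v \<in> V \<Longrightarrow> x \<in> V \<Longrightarrow> lt u v \<Longrightarrow> lt v x \<Longrightarrow> lt u x"
    and nested: "u \<in> V \<Longrightarrow> v \<in> V \<Longrightarrow> {x \<in> V. lt x u} \<subseteq> {x \<in> V. lt x v} \<or> {x \<in> V. lt x v} \<subseteq> {x \<in> V. lt x u}"
begin

definition rank :: "nat \<Rightarrow> nat" where "rank v = card {u \<in> V. lt u v}"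

lemma downset_mono:
  assumes "u \<in> V" "v \<in> V" "rank u \<le> rank v" "x \<in> V" "lt x u"
  shows "lt x v"
proof (cases "{x \<in> V. lt x u} \<subseteq> {x \<in> V. lt x v}")
  case False
  with nested assms(1,2) have "{x \<in> V. lt x v} \<subseteq> {x \<in> V. lt x u}" by blast
  then have "{x \<in> V. lt x v} = {x \<in> V. lt x u}"
    using assms(3) finite_V unfolding rank_def by (intro card_seteq) auto
  with assms(4,5) show ?thesis by blast
qed (use assms in blast)

lemma rank_less: "v \<in> V \<Longrightarrow> rank v < card V"
  unfolding rank_def using irrefl finite_V by (intro psubset_card_mono) auto

definition greedy :: "nat set \<Rightarrow> (nat \<Rightarrow> nat) \<Rightarrow> (nat \<Rightarrow> nat) \<Rightarrow> nat \<Rightarrow> bool" where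
  "greedy P cl hi k \<longleftrightarrow> P \<subseteq> V \<and> (\<forall>v \<in> P. cl v < k) \<and> (\<forall>j < k. hi j \<in> P \<and> cl (hi j) = j) \<and>
     (\<forall>u \<in> P. u = hi (cl u) \<or> lt u (hi (cl u))) \<and>
     (\<forall>u \<in> P. \<forall>v \<in> P. u \<noteq> v \<longrightarrow> cl u = cl v \<longrightarrow> lt u v \<or> lt v u) \<and>
     (\<exists>X \<subseteq> P. card X = k \<and> (\<forall>a \<in> X. \<forall>b \<in> X. \<not> lt a b))"

lemma greedy_empty: "greedy {} cl hi 0"
  by (auto simp: greedy_def)

lemma greedy_bound: "greedy P cl hi k \<Longrightarrow> k \<le> card V"
proof -
  assume "greedy P cl hi k"
  then have "P \<subseteq> V" "\<exists>X \<subseteq> P. card X = k" by (auto simp: greedy_def)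
  then show ?thesis using card_mono[OF finite_V] by (metis order_trans)
qed

text \<open>When a new chain is opened, the tops of all chains together with the new element form an
  antichain: a relation between two tops would put the smaller one below the new element.\<close>

lemma greedy_step:
  assumes g: "greedy P cl hi k" and v: "v \<in> V" "v \<notin> P" and rank: "\<And>u. u \<in> P \<Longrightarrow> rank u \<le> rank v"
    and j: "j \<le> k" "\<And>i. i < j \<Longrightarrow> \<not> lt (hi i) v" "j < k \<Longrightarrow> lt (hi j) v"
  shows "greedy (insert v P) (cl(v := j)) (hi(j := v)) (if j < k then k else Suc k)"
proof -
  from g have PV: "P \<subseteq> V" and cl: "\<And>u. u \<in> P \<Longrightarrow> cl u < k"
    and hi: "\<And>i. i < k \<Longrightarrow> hi i \<in> P" "\<And>i. i < k \<Longrightarrow> cl (hi i) = i"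
    and below: "\<And>u. u \<in> P \<Longrightarrow> u = hi (cl u) \<or> lt u (hi (cl u))"
    and comp: "\<And>u x. u \<in> P \<Longrightarrow> x \<in> P \<Longrightarrow> u \<noteq> x \<Longrightarrow> cl u = cl x \<Longrightarrow> lt u x \<or> lt x u"
    and anti: "\<exists>X \<subseteq> P. card X = k \<and> (\<forall>a \<in> X. \<forall>b \<in> X. \<not> lt a b)"
    unfolding greedy_def by auto
  have ltv: "lt u v" if "u \<in> P" "cl u = j" for u
  proof -
    have "j < k" using cl that by auto
    then show ?thesis using below[OF that(1)] that j(3) trans[of u "hi j" v] hi(1)[of j] v PV by auto
  qed
  have anti': "\<exists>X \<subseteq> insert v P. card X = (if j < k then k else Suc k) \<and> (\<forall>a \<in> X. \<forall>b \<in> X. \<not> lt a b)"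
  proof (cases "j < k")
    case True
    with anti show ?thesis by (metis subset_insertI2)
  next
    case False
    let ?T = "hi ` {..<k}"
    have inj: "inj_on hi {..<k}" by (metis inj_onI lessThan_iff hi(2))
    have TP: "?T \<subseteq> P" using hi by auto
    have tv: "\<not> lt a v" if "a \<in> ?T" for a using that False j by auto
    have "\<not> lt a b" if "a \<in> insert v ?T" "b \<in> insert v ?T" for a b
    proof
      assume ab: "lt a b"
      have inV: "a \<in> V" "b \<in> V" using that TP PV v by auto
      have "rank b \<le> rank v" using that rank TP by auto
      from downset_mono[OF inV(2) v(1) this inV(1) ab] have "lt a v" .
      then show False using tv irrefl[OF v(1)] that by auto
    qed
    moreover have "card (insert v ?T) = Suc k"
      using v(2) TP inj by (subst card_insert_disjoint) (auto simp: card_image)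
    ultimately show ?thesis using False TP
      by (intro exI[of _ "insert v ?T"]) auto
  qed
  have 1: "\<forall>u \<in> insert v P. (cl(v := j)) u < (if j < k then k else Suc k)"
    using cl v j(1) by (auto simp: less_Suc_eq)
  have 2: "\<forall>i < (if j < k then k else Suc k). (hi(j := v)) i \<in> insert v P \<and>
      (cl(v := j)) ((hi(j := v)) i) = i"
    using hi v j(1) by (auto simp: less_Suc_eq)
  have 3: "\<forall>u \<in> insert v P. u = (hi(j := v)) ((cl(v := j)) u) \<or> lt u ((hi(j := v)) ((cl(v := j)) u))"
    using below ltv v by auto
  have 4: "\<forall>u \<in> insert v P. \<forall>x \<in> insert v P. u \<noteq> x \<longrightarrow> (cl(v := j)) u = (cl(v := j)) x \<longrightarrow>
      lt u x \<or> lt x u"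
    using comp ltv by auto
  show ?thesis unfolding greedy_def using 1 2 3 4 anti' PV v by blast
qed

end

definition count_com :: com where
  "count_com = pairs_com (If (Equal (arr 3 (idx (Const 0) (Reg ''u'') (Reg ''v''))) (Const 0))
     (sto 7 (Reg ''v'') (Add (arr 7 (Reg ''v'')) (Const 1))) Skip)"

definition probe_com :: com where
  "probe_com = While (And (Less (Reg ''j'') (Reg ''k''))
       (Equal (arr 3 (idx (Const 0) (arr 8 (Reg ''j'')) (Reg ''v''))) (Const 1)))
     (Assign ''j'' (Add (Reg ''j'') (Const 1)))"

definition greedy_com :: com where
  "greedy_com = Seq (Assign ''k'' (Const 0)) (pairs_com
     (If (Equal (arr 7 (Reg ''v'')) (Reg ''u''))
       (Seq (Assign ''j'' (Const 0)) (Seq probe_com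
       (Seq (sto 9 (Reg ''v'') (Reg ''j'')) (Seq (sto 8 (Reg ''j'') (Reg ''v''))
         (If (Less (Reg ''j'') (Reg ''k'')) Skip (Assign ''k'' (Add (Reg ''k'') (Const 1))))))))
       Skip))"

locale ordered_layout = instance_layout +
  assumes order: "nested_downsets {..<n} (\<lambda>u v. (0, u, v) \<notin> marked)"
begin

definition lt :: "nat \<Rightarrow> nat \<Rightarrow> bool" where "lt u v \<longleftrightarrow> (0, u, v) \<notin> marked"

sublocale nested_downsets "{..<n}" lt
  using order unfolding lt_def[abs_def] .

definition table :: "(nat \<Rightarrow> nat \<Rightarrow> nat) \<Rightarrow> bool" where
  "table F \<longleftrightarrow> (\<forall>u < n. \<forall>v < n. F 3 (u * n + v) = (if lt u v then 0 else 1))"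

lemma runs_count:
  assumes F: "queue qs \<rho> F" "static F" "set qs = marked"
    and post: "\<And>t \<rho>' F'. table F' \<Longrightarrow> (\<And>v. v < n \<Longrightarrow> F' 7 v = rank v) \<Longrightarrow>
      (\<And>j k. 8 \<le> j \<Longrightarrow> F' j k = 0) \<Longrightarrow> t \<le> 100 * (n * n) + 100 \<Longrightarrow> Q t (mk \<rho>' F')"
  shows "runs w count_com (mk \<rho> F) Q"
proof -
  define I where "I = (\<lambda>S (\<rho> :: string \<Rightarrow> nat) F'. table F' \<and>
    (\<forall>v < n. F' 7 v = card {u. (u, v) \<in> S \<and> lt u v}) \<and> (\<forall>j \<ge> 8. \<forall>k. F' j k = 0))"
  show ?thesis unfolding count_com_def
  proof (rule runs_pairs[where I = I and T = "\<lambda>_. 50"], goal_cases)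
    case 1
    have "F 3 ((0 * n + u) * n + v) = (if (0, u, v) \<in> set qs then 1 else 0)" if "u < n" "v < n" for u v
      using F(1) that unfolding queue_def by (metis pos2)
    then have "F 3 (u * n + v) = (if (0, u, v) \<in> marked then 1 else 0)" if "u < n" "v < n" for u v
      using that F(3) by simp
    then show ?case using F(2) by (auto simp: I_def table_def static_def lt_def)
  next
    case (2 S \<rho> F r a)
    then show ?case by (simp add: I_def)
  next
    case (3 u v \<rho>' F')
    have b: "u * n + v < limit" "v < limit"
      using pair_less[OF 3(1,2)] 3(2) limits by linarith+
    have tab: "F' 3 (u * n + v) = (if lt u v then 0 else 1)" using 3 by (auto simp: I_def table_def)
    have fin: "finite {u'. (u', v') \<in> before u v \<and> lt u' v'}" for v'
      by (rule finite_subset[of _ "{..<n}"]) (auto simp: before_def)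
    have F7: "F' 7 v' = card {u'. (u', v') \<in> before u v \<and> lt u' v'}" if "v' < n" for v'
      using 3 that by (auto simp: I_def)
    have "F' 7 v \<le> card {..<n}"
      unfolding F7[OF 3(2)] by (intro card_mono) (auto simp: before_def)
    then have sm: "Suc (F' 7 v) < 2 ^ w" "Suc 0 < 2 ^ w" using limits base_limit unfolding card_lessThan by linarith+
    have new: "card {u'. (u', v') \<in> insert (u, v) (before u v) \<and> lt u' v'} =
      (if v' = v \<and> lt u v then Suc (F' 7 v) else F' 7 v')" if "v' < n" for v'
    proof (cases "v' = v \<and> lt u v")
      case True
      then have "{u'. (u', v') \<in> insert (u, v) (before u v) \<and> lt u' v'} =
        insert u {u'. (u', v') \<in> before u v \<and> lt u' v'}" by auto
      moreover have "u \<notin> {u'. (u', v') \<in> before u v \<and> lt u' v'}" using True by (auto simp: before_def)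
      ultimately show ?thesis using True fin F7[OF that] by simp
    next
      case False
      then have "{u'. (u', v') \<in> insert (u, v) (before u v) \<and> lt u' v'} =
        {u'. (u', v') \<in> before u v \<and> lt u' v'}" by auto
      then show ?thesis unfolding F7[OF that] using False by auto
    qed
    show ?case
      apply (intro runs_intros)
            apply (simp_all add: regs_mk safe_arr safe_idx 3 b sm tab)
       apply (rule endsI)
      subgoal using 3 new by (auto simp: I_def table_def split: if_splits)
      apply (rule endsI)
      using 3 new by (auto simp: I_def split: if_splits)
  next
    case (4 \<rho>' F' t)
    have "{u. (u, v) \<in> pairs \<and> lt u v} = {u \<in> {..<n}. lt u v}" if "v < n" for v using that by auto
    with 4 show ?case by (intro post) (auto simp: I_def rank_def)
  qed
qed

lemma runs_probe:
  assumes tab: "table F" and v: "\<rho> ''v'' < n" and j: "\<rho> ''j'' = 0" and k: "\<rho> ''k'' \<le> n"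
    and hi: "\<And>i. F 8 i < n"
    and post: "\<And>t j. j \<le> \<rho> ''k'' \<Longrightarrow> (\<And>i. i < j \<Longrightarrow> \<not> lt (F 8 i) (\<rho> ''v'')) \<Longrightarrow>
      (j < \<rho> ''k'' \<Longrightarrow> lt (F 8 j) (\<rho> ''v'')) \<Longrightarrow> t \<le> 60 * n + 60 \<Longrightarrow> Q t (mk (\<rho>(''j'' := j)) F)"
  shows "runs w probe_com (mk \<rho> F) Q"
proof -
  define I where "I = (\<lambda>j \<rho>' F'. F' = F \<and> \<rho>' = \<rho>(''j'' := j) \<and> j \<le> \<rho> ''k'' \<and>
    (\<forall>i < j. \<not> lt (F 8 i) (\<rho> ''v'')))"
  have T: "F 3 (F 8 i * n + \<rho> ''v'') = (if lt (F 8 i) (\<rho> ''v'') then 0 else 1)" for i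
    using tab hi v by (auto simp: table_def)
  have lim: "F 8 i * n + \<rho> ''v'' < limit" for i
    using pair_less[OF hi[of i] v] limits by linarith
  show ?thesis unfolding probe_com_def
  proof (rule runs_while[where I = I and g = 0 and \<Phi> = "\<lambda>j. 60 * (\<rho> ''k'' - j)"], goal_cases)
    case 1
    then show ?case using j by (auto simp: I_def fun_upd_idem)
  next
    case (2 j \<rho>' F')
    then have "j < limit" "Suc 0 < 2 ^ w" using k limits base_limit by (auto simp: I_def)
    with 2 show ?case by (simp add: I_def regs_mk safe_arr safe_idx hi v lim)
  next
    case (3 j \<rho>' F')
    then have *: "F' = F" "\<rho>' = \<rho>(''j'' := j)" "j < \<rho> ''k''" "\<forall>i < j. \<not> lt (F 8 i) (\<rho> ''v'')"
      "\<not> lt (F 8 j) (\<rho> ''v'')"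
      by (auto simp: I_def regs_mk T split: if_splits)
    have "Suc j < 2 ^ w" "Suc 0 < 2 ^ w" using *(3) k limits base_limit by linarith+
    then show ?case
      apply (intro runs_intros)
        apply (simp_all add: regs_mk *)
      apply (rule reachesI[where g = "Suc j"])
      using * by (auto simp: I_def less_Suc_eq)
  next
    case (4 j \<rho>' F' t)
    then have *: "F' = F" "\<rho>' = \<rho>(''j'' := j)" "j \<le> \<rho> ''k''" "\<forall>i < j. \<not> lt (F 8 i) (\<rho> ''v'')"
      by (auto simp: I_def)
    from 4(2) have "j < \<rho> ''k'' \<Longrightarrow> lt (F 8 j) (\<rho> ''v'')"
      by (auto simp: * regs_mk T split: if_splits)
    moreover have "t \<le> 60 * n + 60" using 4(3) k by simp
    ultimately show ?case unfolding * using * by (intro post) auto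
  qed
qed

lemma runs_greedy:
  assumes F: "table F" "\<And>v. v < n \<Longrightarrow> F 7 v = rank v" "\<And>j k. 8 \<le> j \<Longrightarrow> F j k = 0"
    and post: "\<And>t \<rho>' F' hi k. greedy {..<n} (F' 9) hi k \<Longrightarrow>
      t \<le> 500 * (n * n) + 100 \<Longrightarrow> Q t (mk \<rho>' F')"
  shows "runs w greedy_com (mk \<rho> F) Q"
proof -
  define seen where "seen = (\<lambda>S. {v. v < n \<and> (rank v, v) \<in> S})"
  define I where "I = (\<lambda>S \<rho>' F'. table F' \<and> (\<forall>v < n. F' 7 v = rank v) \<and> (\<forall>i. F' 8 i < n) \<and>
    greedy (seen S) (F' 9) (F' 8) (\<rho>' ''k''))"
  define T where "T = (\<lambda>(d, v). if d = rank v then 60 * n + 200 else 50)"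
  show ?thesis unfolding greedy_com_def
    apply (intro runs_intros)
      apply simp
     apply simp
    subgoal
    proof (rule runs_pairs[where I = I and T = T], goal_cases)
      case 1
      show ?case using F n_pos by (auto simp: I_def seen_def greedy_empty)
    next
      case (2 S \<rho> F r a)
      then show ?case by (auto simp: I_def)
    next
      case (3 d v \<rho>' F')
      then have I: "table F'" "\<forall>v < n. F' 7 v = rank v" "\<And>i. F' 8 i < n"
        "greedy (seen (before d v)) (F' 9) (F' 8) (\<rho>' ''k'')" by (auto simp: I_def)
      have kn: "\<rho>' ''k'' \<le> n" using greedy_bound[OF I(4)] by simp
      have sm: "v < limit" "Suc (\<rho>' ''k'') < 2 ^ w" "Suc 0 < 2 ^ w"
        using kn 3 limits base_limit by linarith+
      have new: "seen (insert (d, v) (before d v)) =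
        (if rank v = d then insert v (seen (before d v)) else seen (before d v))"
        using 3 by (auto simp: seen_def)
      have r: "rank u \<le> d" if "u \<in> seen (before d v)" for u
        using that by (auto simp: seen_def before_def)
      have vs: "v \<notin> seen (before d v)" if "rank v = d" using that by (auto simp: seen_def before_def)
      show ?case
        apply (intro runs_intros)
             apply (simp_all add: regs_mk safe_arr 3 I sm)
         apply (rule runs_probe)
              apply (use 3 I kn in simp_all)
        subgoal premises prems for t j
        proof -
          have jl: "j < limit" using prems(2) kn limits by linarith
          have "greedy (insert v (seen (before d v))) ((F' 9)(v := j)) ((F' 8)(j := v))
            (if j < \<rho>' ''k'' then \<rho>' ''k'' else Suc (\<rho>' ''k''))"
            using prems r vs 3 by (intro greedy_step[OF I(4)]) auto
          then show ?thesis using prems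
            apply (intro runs_intros)
                      apply (simp_all add: regs_mk 3 sm jl)
             apply (rule endsI)
            subgoal using I(1-3) 3 new by (simp add: I_def table_def T_def)
            apply (rule endsI)
            using I(1-3) 3 new by (simp add: I_def table_def T_def)
        qed
        apply (rule endsI)
        using I 3 new by (simp add: I_def T_def)
    next
      case (4 \<rho>' F' t)
      have "seen pairs = {..<n}" using rank_less by (auto simp: seen_def)
      moreover have "(\<Sum>p\<in>pairs. T p + 30) \<le> 400 * (n * n)"
      proof -
        have "(\<Sum>p\<in>pairs. T p + 30) = (\<Sum>v<n. \<Sum>d<n. T (d, v) + 30)"
          by (subst sum.swap) (simp add: sum.cartesian_product)
        also have "\<dots> \<le> (\<Sum>v<n. \<Sum>d<n. (if d = rank v then 60 * n + 200 else 0) + 80)"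
          by (intro sum_mono) (auto simp: T_def)
        also have "\<dots> = (\<Sum>v<n. (60 * n + 200) + 80 * n)"
          using rank_less by (intro sum.cong) (auto simp: sum.distrib)
        also have "\<dots> = 140 * (n * n) + 200 * n" by (simp add: algebra_simps)
        also have "\<dots> \<le> 400 * (n * n)" using n_pos by simp
        finally show ?thesis .
      qed
      ultimately show ?case using 4 by (intro post) (auto simp: I_def)
    qed
    done
qed

end

section \<open>The order on the states\<close>

lemma not_colex_less_Nil [simp]: "\<not> colex_less \<alpha> []"
  by (auto elim: colex_less.cases)

lemma colex_less_Nil [simp]: "colex_less [] \<beta> \<longleftrightarrow> \<beta> \<noteq> []"
  by (auto intro: colex_less.intros)

lemma colex_less_snoc [simp]:
  "colex_less (\<alpha> @ [a]) (\<beta> @ [b]) \<longleftrightarrow> a < b \<or> a = b \<and> colex_less \<alpha> \<beta>"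
  by (auto intro: colex_less.intros elim: colex_less.cases)

lemma colex_less_iff_lexord: "colex_less (rev \<alpha>) (rev \<beta>) \<longleftrightarrow> (\<alpha>, \<beta>) \<in> lexord {(a, b). a < b}"
proof (induction \<alpha> arbitrary: \<beta>)
  case Nil
  show ?case by (cases \<beta>) auto
next
  case (Cons a \<alpha>)
  then show ?case by (cases \<beta>) auto
qed

lemma colex_less_irrefl: "\<not> colex_less \<alpha> \<alpha>"
  by (induction \<alpha> rule: rev_induct) auto

lemma colex_less_trans:
  fixes \<alpha> \<beta> \<gamma> :: "'a::linorder list"
  assumes "colex_less \<alpha> \<beta>" "colex_less \<beta> \<gamma>"
  shows "colex_less \<alpha> \<gamma>"
proof -
  have "Relation.trans {(a::'a, b). a < b}" by (auto intro: transI)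
  with assms colex_less_iff_lexord[of "rev \<alpha>" "rev \<beta>"] colex_less_iff_lexord[of "rev \<beta>" "rev \<gamma>"]
    colex_less_iff_lexord[of "rev \<alpha>" "rev \<gamma>"]
  show ?thesis by (metis lexord_trans rev_rev_ident)
qed

lemma colex_less_linear: "colex_less \<alpha> \<beta> \<or> \<alpha> = \<beta> \<or> colex_less \<beta> \<alpha>" for \<alpha> \<beta> :: "'a::linorder list"
proof -
  have "\<forall>a b. (a, b) \<in> {(a::'a, b). a < b} \<or> a = b \<or> (b, a) \<in> {(a, b). a < b}" by auto
  from lexord_linear[OF this, of "rev \<alpha>" "rev \<beta>"] show ?thesis
    using colex_less_iff_lexord[of "rev \<alpha>" "rev \<beta>"] colex_less_iff_lexord[of "rev \<beta>" "rev \<alpha>"]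
    by simp
qed

lemma run_snoc: "run A q (\<alpha> @ [a]) = Option.bind (run A q \<alpha>) (\<lambda>q'. trans A q' a)"
  by (induction \<alpha> arbitrary: q) (auto split: bind_splits)

locale presented =
  fixes A :: "('q, 'a::linorder) dfa" and \<nu> \<kappa> ts w
  assumes standing: "standing_assumptions A"
    and pres: "presentation w A \<nu> \<kappa> ts"
    and room: "(card (states A) + card (transitions A) + 2) ^ 7 \<le> (2 :: nat) ^ w"
begin

abbreviation n where "n \<equiv> card (states A)"
abbreviation m where "m \<equiv> length ts"
abbreviation s where "s \<equiv> \<nu> (init A)"
abbreviation I where "I \<equiv> strings_to A"

definition inp :: "nat \<Rightarrow> nat" where "inp = mem (initial_machine (encode A \<nu> \<kappa> ts))"

lemma wf: "finite (states A)" "init A \<in> states A"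
  "trans A u a = Some v \<Longrightarrow> u \<in> states A \<and> a \<in> alphabet A \<and> v \<in> states A"
  using standing unfolding standing_assumptions_def wf_dfa_def by blast+

lemma init_no_incoming: "trans A u a \<noteq> Some (init A)"
  using standing unfolding standing_assumptions_def by blast

lemma strings_nonempty: "q \<in> states A \<Longrightarrow> \<exists>\<alpha>. \<alpha> \<in> I q"
  using standing unfolding standing_assumptions_def by blast

lemma same_letter: "trans A u a = Some v \<Longrightarrow> trans A u' b = Some v \<Longrightarrow> a = b"
  using standing unfolding standing_assumptions_def input_consistent_def by blast

lemma \<nu>_bij: "bij_betw \<nu> (states A) {..<n}"
  and \<kappa>_mono: "strict_mono_on (alphabet A) \<kappa>"
  and \<kappa>_word: "\<kappa> ` alphabet A \<subseteq> {..<2 ^ w}"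
  and distinct_ts: "distinct ts"
  and set_ts: "set ts = transitions A"
  using pres unfolding presentation_def by blast+

lemma \<nu>_less: "q \<in> states A \<Longrightarrow> \<nu> q < n"
  using \<nu>_bij by (auto simp: bij_betw_def)

lemma \<nu>_inj: "p \<in> states A \<Longrightarrow> q \<in> states A \<Longrightarrow> \<nu> p = \<nu> q \<Longrightarrow> p = q"
  using \<nu>_bij by (auto simp: bij_betw_def inj_on_def)

lemma \<nu>_surj: "v < n \<Longrightarrow> \<exists>q \<in> states A. v = \<nu> q"
  using \<nu>_bij by (auto simp: bij_betw_def)

lemma \<kappa>_less: "a \<in> alphabet A \<Longrightarrow> b \<in> alphabet A \<Longrightarrow> \<kappa> a < \<kappa> b \<longleftrightarrow> a < b"
  using \<kappa>_mono by (metis linorder_neqE less_asym strict_mono_onD less_irrefl)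

lemma \<kappa>_inj: "a \<in> alphabet A \<Longrightarrow> b \<in> alphabet A \<Longrightarrow> \<kappa> a = \<kappa> b \<Longrightarrow> a = b"
  by (metis \<kappa>_less less_irrefl linorder_neqE)

lemma m_eq: "m = card (transitions A)"
  using distinct_card[OF distinct_ts] set_ts by simp

lemma concat_triples:
  "length (concat (map (\<lambda>(u, v, a). [f u, f v, g a]) xs)) = 3 * length xs"
  "e < length xs \<Longrightarrow> xs ! e = (u, v, a) \<Longrightarrow> i < 3 \<Longrightarrow>
     concat (map (\<lambda>(u, v, a). [f u, f v, g a]) xs) ! (3 * e + i) = [f u, f v, g a] ! i"
proof (induction xs arbitrary: e)
  case (Cons x xs)
  {
    case 1
    show ?case using Cons.IH(1) by (simp add: case_prod_unfold)
  next
    case 2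
    show ?case
    proof (cases e)
      case 0
      with 2 show ?thesis by (auto simp: less_Suc_eq numeral_3_eq_3)
    next
      case (Suc e')
      with 2 Cons.IH(2)[of e'] show ?thesis by (auto simp: case_prod_unfold nth_append)
    qed
  }
qed simp_all

lemma length_encode: "length (encode A \<nu> \<kappa> ts) = 3 + 3 * m + n"
  by (simp add: encode_def concat_triples(1))

lemma inp_header: "inp 0 = n" "inp 1 = m" "inp 2 = s"
  by (simp_all add: inp_def initial_machine_def length_encode) (simp_all add: encode_def)

lemma inp_edge:
  assumes "e < m" "ts ! e = (u, v, a)"
  shows "inp (3 + 3 * e) = \<nu> u" "inp (4 + 3 * e) = \<nu> v" "inp (5 + 3 * e) = \<kappa> a"
proof -
  have "inp (3 + (3 * e + i)) = [\<nu> u, \<nu> v, \<kappa> a] ! i" if "i < 3" for i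
    using concat_triples(2)[OF assms that, of \<nu> \<kappa>] that assms(1)
    by (simp add: inp_def initial_machine_def length_encode)
      (simp add: encode_def nth_append concat_triples(1))
  from this[of 0] this[of 1] this[of 2] show "inp (3 + 3 * e) = \<nu> u" "inp (4 + 3 * e) = \<nu> v"
    "inp (5 + 3 * e) = \<kappa> a" by (simp_all add: eval_nat_numeral)
qed

lemma edgeE:
  assumes "e < m"
  obtains u v a where "trans A u a = Some v" "inp (3 + 3 * e) = \<nu> u" "inp (4 + 3 * e) = \<nu> v"
    "inp (5 + 3 * e) = \<kappa> a" "u \<in> states A" "v \<in> states A" "a \<in> alphabet A"
proof -
  obtain u v a where *: "ts ! e = (u, v, a)" by (metis prod_cases3)
  then have "(u, v, a) \<in> transitions A" using assms set_ts nth_mem by metis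
  then have "trans A u a = Some v" by (simp add: transitions_def)
  with inp_edge[OF assms *] wf(3) that show thesis by blast
qed

lemma edgeI:
  assumes "trans A u a = Some v"
  obtains e where "e < m" "inp (3 + 3 * e) = \<nu> u" "inp (4 + 3 * e) = \<nu> v" "inp (5 + 3 * e) = \<kappa> a"
proof -
  have "(u, v, a) \<in> set ts" using assms set_ts by (simp add: transitions_def)
  then obtain e where "e < m" "ts ! e = (u, v, a)" by (auto simp: in_set_conv_nth)
  with inp_edge that show thesis by blast
qed

lemma room100: "100 * (n + m + 2)\<^sup>2 \<le> 2 ^ w"
proof -
  have "n > 0" using wf card_gt_0_iff by blast
  then have "(3::nat) ^ 5 \<le> (n + m + 2) ^ 5" by (intro power_mono) auto
  then have "100 * (n + m + 2)\<^sup>2 \<le> (n + m + 2) ^ 5 * (n + m + 2)\<^sup>2" by (intro mult_right_mono) auto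
  also have "\<dots> = (n + m + 2) ^ 7" by (simp flip: power_add)
  also have "\<dots> \<le> 2 ^ w" using room m_eq by simp
  finally show ?thesis .
qed

sublocale instance_layout w n m s inp
proof
  show "s < n" using \<nu>_less wf by blast
  show "100 * (n + m + 2)\<^sup>2 \<le> 2 ^ w" by (rule room100)
  show "inp (3 + 3 * e) < n" if "e < m" for e using edgeE[OF that] \<nu>_less by metis
  show "inp (4 + 3 * e) < n" if "e < m" for e using edgeE[OF that] \<nu>_less by metis
  show "inp (4 + 3 * e) \<noteq> s" if "e < m" for e
    using edgeE[OF that] init_no_incoming \<nu>_inj wf(2) by metis
  show "inp (5 + 3 * e) = inp (5 + 3 * f)" if "e < m" "f < m" "inp (4 + 3 * e) = inp (4 + 3 * f)" for e f
    by (rule edgeE[OF that(1)], rule edgeE[OF that(2)]) (metis that(3) \<nu>_inj same_letter)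
qed

lemma strings_Nil: "[] \<in> I q \<longleftrightarrow> q = init A"
  by (auto simp: strings_to_def)

lemma strings_snoc: "\<alpha> @ [a] \<in> I q \<longleftrightarrow> (\<exists>p. \<alpha> \<in> I p \<and> trans A p a = Some q)"
  using wf(3) by (auto simp: strings_to_def run_snoc bind_eq_Some_conv)

lemma strings_state: "\<alpha> \<in> I q \<Longrightarrow> q \<in> states A"
  using wf(2,3) by (cases \<alpha> rule: rev_cases) (auto simp: strings_Nil strings_snoc)

lemma label_trans: "trans A p a = Some q \<Longrightarrow> label (\<nu> q) = \<kappa> a"
  by (erule edgeI) (metis dst_def lab_edge lbl_def order_refl)

lemma label_init: "label s = 0"
  using dst_not_init by (auto simp: lab_def dst_def)

text \<open>Entries with first component 1 are half steps: only the smaller string has been prolonged, and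
  the components are swapped.\<close>

definition witness :: "nat \<times> nat \<times> nat \<Rightarrow> bool" where
  "witness = (\<lambda>(t, x, y).
     if t = 0 then \<exists>p q \<alpha> \<beta>. x = \<nu> p \<and> y = \<nu> q \<and> \<alpha> \<in> I p \<and> \<beta> \<in> I q \<and> \<not> colex_less \<alpha> \<beta>
     else \<exists>p q q' a \<alpha> \<beta>. x = \<nu> q \<and> y = \<nu> p \<and> trans A q' a = Some q \<and> \<alpha> \<in> I p \<and> \<beta> \<in> I q' \<and>
       \<not> colex_less \<alpha> \<beta>)"

lemma witness_if_marked: "x \<in> marked \<Longrightarrow> witness x"
proof (induction rule: marked.induct)
  case (seed x)
  then obtain u v where x: "x = (0, u, v)" "u < n" "v < n" "v = s \<or> label v < label u"
    by (auto simp: seeds_def)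
  obtain p q where pq: "p \<in> states A" "q \<in> states A" "u = \<nu> p" "v = \<nu> q" using \<nu>_surj x by metis
  obtain \<alpha> where \<alpha>: "\<alpha> \<in> I p" using strings_nonempty pq by blast
  obtain \<beta> where \<beta>: "\<beta> \<in> I q" "v = s \<Longrightarrow> \<beta> = []"
    using strings_nonempty pq strings_Nil \<nu>_inj wf(2) by metis
  have "\<not> colex_less \<alpha> \<beta>"
  proof (cases \<beta> rule: rev_cases)
    case (snoc \<beta>' b)
    with \<beta> x have l: "label v < label u" by auto
    show ?thesis
    proof (cases \<alpha> rule: rev_cases)
      case Nil
      with \<alpha> have "u = s" using pq strings_Nil by simp
      with l label_init show ?thesis by simp
    next
      case (snoc \<alpha>' a)
      obtain p' q' where "trans A p' a = Some p" "trans A q' b = Some q"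
        using \<alpha> \<beta> snoc \<open>\<beta> = \<beta>' @ [b]\<close> by (auto simp: strings_snoc)
      then have "\<kappa> b < \<kappa> a" "a \<in> alphabet A" "b \<in> alphabet A"
        using l label_trans pq wf(3) by auto
      then have "b < a" using \<kappa>_less by blast
      then show ?thesis using snoc \<open>\<beta> = \<beta>' @ [b]\<close> by auto
    qed
  qed simp
  then show ?case using \<alpha> \<beta> pq x by (auto simp: witness_def)
next
  case (step x x')
  obtain t y z where x: "x = (t, y, z)" by (metis prod_cases3)
  with step.hyps obtain e where e: "e < m" "src e = z" "x' = (1 - t, dst e, y)"
    "t = 0 \<or> label (dst e) = label y" by (auto simp: succs_def)
  obtain u v a where edge: "trans A u a = Some v" "src e = \<nu> u" "dst e = \<nu> v"
    "u \<in> states A" "v \<in> states A" using edgeE[OF e(1)] unfolding src_def dst_def by metis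
  show ?case
  proof (cases "t = 0")
    case True
    with step.IH x obtain p q \<alpha> \<beta> where *: "y = \<nu> p" "z = \<nu> q" "\<alpha> \<in> I p" "\<beta> \<in> I q" "\<not> colex_less \<alpha> \<beta>"
      by (auto simp: witness_def)
    have "u = q" using * e edge \<nu>_inj strings_state by metis
    with * True e edge show ?thesis by (simp add: witness_def) blast
  next
    case False
    with step.IH x obtain p q q' b \<alpha> \<beta> where *: "y = \<nu> q" "z = \<nu> p" "trans A q' b = Some q" "\<alpha> \<in> I p"
      "\<beta> \<in> I q'" "\<not> colex_less \<alpha> \<beta>" by (auto simp: witness_def)
    have "u = p" using * e edge \<nu>_inj strings_state by metis
    have "\<kappa> a = \<kappa> b" using label_trans[OF edge(1)] label_trans[OF *(3)] e False * edge by simp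
    then have "a = b" using \<kappa>_inj wf(3) edge(1) *(3) by blast
    then have "\<alpha> @ [a] \<in> I v" "\<beta> @ [a] \<in> I q" "\<not> colex_less (\<alpha> @ [a]) (\<beta> @ [a])"
      using * edge \<open>u = p\<close> by (auto simp: strings_snoc)
    moreover have "x' = (0, \<nu> v, \<nu> q)" using * edge e False by simp
    ultimately show ?thesis unfolding witness_def by (simp, blast)
  qed
qed

lemma marked_if_not_colex_less:
  "\<alpha> \<in> I p \<Longrightarrow> \<beta> \<in> I q \<Longrightarrow> \<not> colex_less \<alpha> \<beta> \<Longrightarrow> (0, \<nu> p, \<nu> q) \<in> marked"
proof (induction \<beta> arbitrary: \<alpha> p q rule: rev_induct)
  case Nil
  then have "(0, \<nu> p, \<nu> q) \<in> seeds"
    using \<nu>_less strings_state strings_Nil by (auto simp: seeds_def)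
  then show ?case by (rule marked.seed)
next
  case (snoc b \<beta>)
  then obtain \<alpha>' a where \<alpha>: "\<alpha> = \<alpha>' @ [a]" by (cases \<alpha> rule: rev_cases) auto
  obtain p' q' where *: "\<alpha>' \<in> I p'" "trans A p' a = Some p" "\<beta> \<in> I q'" "trans A q' b = Some q"
    using snoc.prems \<alpha> by (auto simp: strings_snoc)
  have al: "a \<in> alphabet A" "b \<in> alphabet A" "p \<in> states A" "q \<in> states A" using * wf(3) by blast+
  from snoc.prems(3) \<alpha> consider "b < a" | "a = b" "\<not> colex_less \<alpha>' \<beta>" by fastforce
  then show ?case
  proof cases
    case 1
    then have "label (\<nu> q) < label (\<nu> p)" using al \<kappa>_less label_trans * by metis
    then have "(0, \<nu> p, \<nu> q) \<in> seeds" using \<nu>_less al by (auto simp: seeds_def)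
    then show ?thesis by (rule marked.seed)
  next
    case 2
    have "(0, \<nu> p', \<nu> q') \<in> marked" using snoc.IH * 2 by blast
    moreover obtain e f where
      "e < m" "inp (3 + 3 * e) = \<nu> q'" "inp (4 + 3 * e) = \<nu> q"
      "f < m" "inp (3 + 3 * f) = \<nu> p'" "inp (4 + 3 * f) = \<nu> p" using edgeI *(2,4) by metis
    then have "(1, \<nu> q, \<nu> p') \<in> succs 0 (0, \<nu> p', \<nu> q')" "(0, \<nu> p, \<nu> q) \<in> succs 0 (1, \<nu> q, \<nu> p')"
      using label_trans[OF *(2)] label_trans[OF *(4)] 2
      by (auto simp: succs_def src_def dst_def intro: exI[of _ e] exI[of _ f])
    ultimately show ?thesis by (blast intro: marked.step)
  qed
qed

lemma marked_iff:
  assumes "p \<in> states A" "q \<in> states A"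
  shows "(0, \<nu> p, \<nu> q) \<notin> marked \<longleftrightarrow> state_less A p q"
proof
  assume "(0, \<nu> p, \<nu> q) \<notin> marked"
  then show "state_less A p q"
    using assms marked_if_not_colex_less by (auto simp: state_less_def)
next
  assume *: "state_less A p q"
  show "(0, \<nu> p, \<nu> q) \<notin> marked"
  proof
    assume "(0, \<nu> p, \<nu> q) \<in> marked"
    from witness_if_marked[OF this] obtain p' q' \<alpha> \<beta> where
      "\<nu> p = \<nu> p'" "\<nu> q = \<nu> q'" "\<alpha> \<in> I p'" "\<beta> \<in> I q'" "\<not> colex_less \<alpha> \<beta>" by (auto simp: witness_def)
    moreover then have "p = p'" "q = q'" using assms \<nu>_inj strings_state by blast+
    ultimately show False using * by (auto simp: state_less_def)
  qed
qed

lemma state_less_irrefl: "\<not> state_less A p p"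
  using strings_nonempty colex_less_irrefl by (metis state_less_def)

lemma state_less_trans: "state_less A p q \<Longrightarrow> state_less A q r \<Longrightarrow> state_less A p r"
  using strings_nonempty colex_less_trans unfolding state_less_def by meson

lemma state_less_nested:
  assumes "p \<in> states A" "q \<in> states A"
  shows "{x. state_less A x p} \<subseteq> {x. state_less A x q} \<or> {x. state_less A x q} \<subseteq> {x. state_less A x p}"
proof (rule ccontr)
  assume "\<not> ?thesis"
  then obtain a b where ab: "state_less A a p" "\<not> state_less A a q" "state_less A b q" "\<not> state_less A b p"
    by blast
  then obtain \<alpha> \<beta> \<gamma> \<delta> where "\<alpha> \<in> I a" "\<beta> \<in> I q" "\<not> colex_less \<alpha> \<beta>" "\<gamma> \<in> I b" "\<delta> \<in> I p" "\<not> colex_less \<gamma> \<delta>"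
    using assms unfolding state_less_def by blast
  moreover from this have "colex_less \<alpha> \<delta>" "colex_less \<gamma> \<beta>" using ab unfolding state_less_def by blast+
  ultimately show False using colex_less_linear colex_less_trans by metis
qed

sublocale ordered_layout w n m s inp
proof
  show "finite {..<n}" by simp
  show "\<not> (0, v, v) \<notin> marked" if "v \<in> {..<n}" for v
    using that \<nu>_surj[of v] marked_iff state_less_irrefl by auto
  show "(0, u, x) \<notin> marked"
    if uvx: "u \<in> {..<n}" "v \<in> {..<n}" "x \<in> {..<n}" and lt: "(0, u, v) \<notin> marked" "(0, v, x) \<notin> marked" for u v x
  proof -
    obtain p q r where "p \<in> states A" "q \<in> states A" "r \<in> states A" "u = \<nu> p" "v = \<nu> q" "x = \<nu> r"
      using uvx \<nu>_surj by (metis lessThan_iff)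
    with lt show ?thesis using state_less_trans[of p q r] by (simp add: marked_iff)
  qed
  show "{x \<in> {..<n}. (0, x, u) \<notin> marked} \<subseteq> {x \<in> {..<n}. (0, x, v) \<notin> marked} \<or>
     {x \<in> {..<n}. (0, x, v) \<notin> marked} \<subseteq> {x \<in> {..<n}. (0, x, u) \<notin> marked}"
    if uv: "u \<in> {..<n}" "v \<in> {..<n}" for u v
  proof -
    obtain p q where pq: "p \<in> states A" "q \<in> states A" "u = \<nu> p" "v = \<nu> q"
      using uv \<nu>_surj by (metis lessThan_iff)
    have sub: "{x \<in> {..<n}. (0, x, \<nu> a) \<notin> marked} \<subseteq> {x \<in> {..<n}. (0, x, \<nu> b) \<notin> marked}"
      if ab: "a \<in> states A" "b \<in> states A" and le: "{x. state_less A x a} \<subseteq> {x. state_less A x b}" for a b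
    proof
      fix x assume x: "x \<in> {x \<in> {..<n}. (0, x, \<nu> a) \<notin> marked}"
      then obtain y where y: "y \<in> states A" "x = \<nu> y" using \<nu>_surj by auto
      with x ab have "state_less A y a" by (simp add: marked_iff)
      with le have "state_less A y b" by blast
      with x y ab show "x \<in> {x \<in> {..<n}. (0, x, \<nu> b) \<notin> marked}" by (simp add: marked_iff)
    qed
    show ?thesis unfolding pq(3,4) using state_less_nested[OF pq(1,2)] sub pq(1,2) by blast
  qed
qed

lemma lt_iff: "p \<in> states A \<Longrightarrow> q \<in> states A \<Longrightarrow> lt (\<nu> p) (\<nu> q) \<longleftrightarrow> state_less A p q"
  using marked_iff by (simp add: lt_def)

lemma decode_min_chain_partition:
  assumes g: "greedy {..<n} cl hi k" and \<sigma>: "\<And>v. v < n \<Longrightarrow> mem \<sigma> v = cl v"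
  shows "min_chain_partition A (decode A \<nu> \<sigma>)"
proof -
  have mem: "mem \<sigma> (\<nu> q) = cl (\<nu> q)" if "q \<in> states A" for q using that \<sigma> \<nu>_less by blast
  have dec: "decode A \<nu> \<sigma> = (\<lambda>j. {q \<in> states A. cl (\<nu> q) = j}) ` (cl ` \<nu> ` states A)"
    unfolding decode_def image_image by (rule image_cong) (auto simp: mem)
  have "partition_on (states A) (decode A \<nu> \<sigma>)"
    unfolding dec by (rule partition_onI) (auto simp: disjnt_def)
  moreover have "state_less A u v \<or> state_less A v u"
    if "C \<in> decode A \<nu> \<sigma>" "u \<in> C" "v \<in> C" "u \<noteq> v" for C u v
  proof -
    have uv: "u \<in> states A" "v \<in> states A" "cl (\<nu> u) = cl (\<nu> v)" using that unfolding dec by auto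
    moreover have "\<nu> u \<noteq> \<nu> v" using uv that(4) \<nu>_inj by blast
    ultimately show ?thesis using g lt_iff \<nu>_less unfolding greedy_def by (metis lessThan_iff)
  qed
  ultimately have cp: "chain_partition A (decode A \<nu> \<sigma>)" unfolding chain_partition_def by blast
  have "cl ` \<nu> ` states A \<subseteq> {..<k}" using g \<nu>_less unfolding greedy_def by auto
  then have "card (cl ` \<nu> ` states A) \<le> k" using card_mono[of "{..<k}"] by fastforce
  then have le: "card (decode A \<nu> \<sigma>) \<le> k"
    unfolding dec using card_image_le[of "cl ` \<nu> ` states A"] wf(1) by (meson finite_imageI le_trans)
  obtain X where X: "X \<subseteq> {..<n}" "card X = k" "\<forall>a \<in> X. \<forall>b \<in> X. \<not> lt a b"
    using g unfolding greedy_def by blast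
  have "k \<le> card \<P>" if "chain_partition A \<P>" for \<P>
  proof -
    have P: "partition_on (states A) \<P>"
      "\<And>C u v. C \<in> \<P> \<Longrightarrow> u \<in> C \<Longrightarrow> v \<in> C \<Longrightarrow> u \<noteq> v \<Longrightarrow> state_less A u v \<or> state_less A v u"
      using that unfolding chain_partition_def by blast+
    have "\<forall>x \<in> X. \<exists>C. C \<in> \<P> \<and> (\<exists>q \<in> C. x = \<nu> q)"
      using X(1) \<nu>_surj P(1) unfolding partition_on_def by (metis UnionE lessThan_iff subsetD)
    then obtain f where f: "\<And>x. x \<in> X \<Longrightarrow> f x \<in> \<P> \<and> (\<exists>q \<in> f x. x = \<nu> q)" by metis
    have "inj_on f X"
    proof (rule inj_onI, rule ccontr)
      fix x y assume xy: "x \<in> X" "y \<in> X" "f x = f y" "x \<noteq> y"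
      obtain p q where pq: "p \<in> f x" "x = \<nu> p" "q \<in> f x" "y = \<nu> q" using f xy by metis
      then have "p \<in> states A" "q \<in> states A" using P(1) f[OF xy(1)] unfolding partition_on_def by blast+
      moreover have "state_less A p q \<or> state_less A q p" using P(2) f[OF xy(1)] pq xy(4) by metis
      ultimately show False using X(3) xy pq lt_iff by metis
    qed
    moreover have "finite \<P>" using P(1) wf(1) finite_elements by blast
    ultimately show ?thesis using X(2) f card_inj_on_le[of f X \<P>] by blast
  qed
  with cp le show ?thesis unfolding min_chain_partition_def by (meson le_trans)
qed

end

section \<open>The complete program\<close>

definition header_com :: com where
  "header_com = Seq (Assign ''n'' (Load (Const 0))) (Seq (Assign ''m'' (Load (Const 1)))
     (Seq (Assign ''s'' (Load (Const 2)))
       (Assign ''B'' (Add (Add (Const 3) (Mul (Const 3) (Reg ''m''))) (Reg ''n'')))))"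

definition output_com :: com where
  "output_com = Seq (Assign ''v'' (Const 0)) (While (Less (Reg ''v'') (Reg ''n''))
     (Seq (Store (Reg ''v'') (arr 9 (Reg ''v''))) (Assign ''v'' (Add (Reg ''v'') (Const 1)))))"

definition partition_com :: com where
  "partition_com = Seq header_com (Seq adjacency_com (Seq seed_com (Seq search_com
     (Seq count_com (Seq greedy_com output_com)))))"

lemma (in instance_layout) runs_output:
  assumes post: "\<And>t \<sigma>. (\<And>v. v < n \<Longrightarrow> mem \<sigma> v = F 9 v) \<Longrightarrow> t \<le> 50 * n + 50 \<Longrightarrow> Q t \<sigma>"
  shows "runs w output_com (mk \<rho> F) Q"
proof -
  define I where "I = (\<lambda>i (\<sigma> :: machine). i \<le> n \<and> regs \<sigma> ''n'' = n \<and> regs \<sigma> ''B'' = base \<and> regs \<sigma> ''v'' = i \<and>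
    (\<forall>v < i. mem \<sigma> v = F 9 v) \<and> (\<forall>v. mem \<sigma> (base + 9 + 16 * v) = F 9 v))"
  show ?thesis unfolding output_com_def
    apply (intro runs_intros)
      apply simp
     apply simp
    subgoal
    proof (rule runs_While[where I = I and g = 0 and \<Phi> = "\<lambda>i. 50 * (n - i)"], goal_cases)
      case 1
      show ?case using lay_array[of 9 F] by (simp add: I_def regs_mk mem_mk)
    next
      case (2 g \<sigma>)
      then show ?case by simp
    next
      case (3 i \<sigma>)
      then have I: "i < n" "regs \<sigma> ''n'' = n" "regs \<sigma> ''B'' = base" "regs \<sigma> ''v'' = i"
        "\<forall>v < i. mem \<sigma> v = F 9 v" "\<And>v. mem \<sigma> (base + 9 + 16 * v) = F 9 v" by (auto simp: I_def)
      have sm: "Suc i < 2 ^ w" "Suc 0 < 2 ^ w" "9 < (2::nat) ^ w" "16 < (2::nat) ^ w" "base + 9 < 2 ^ w"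
        "16 * i < 2 ^ w" "base + 9 + 16 * i < 2 ^ w"
        using I(1) limits base_limit by linarith+
      have "i < base" using I(1) limits by linarith
      then have ne: "base + 9 + 16 * v \<noteq> i" for v by linarith
      show ?case
        apply (intro runs_Seq runs_Store runs_Assign)
           apply (simp_all add: arr_def I sm)
        apply (rule exI[of _ "Suc i"])
        using I ne by (auto simp: I_def less_Suc_eq)
    next
      case (4 i \<sigma> t)
      then have "i = n" by (simp add: I_def)
      with 4 show ?case by (intro post) (auto simp: I_def)
    qed
    done
qed

context presented
begin

lemma card_states_le: "n \<le> m + 1"
proof -
  have "states A \<subseteq> insert (init A) ((\<lambda>(u, v, a). v) ` transitions A)"
  proof
    fix q assume "q \<in> states A"
    then obtain \<alpha> where \<alpha>: "\<alpha> \<in> I q" using strings_nonempty by blast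
    show "q \<in> insert (init A) ((\<lambda>(u, v, a). v) ` transitions A)"
    proof (cases \<alpha> rule: rev_cases)
      case Nil
      with \<alpha> show ?thesis by (simp add: strings_Nil)
    next
      case (snoc \<beta> a)
      with \<alpha> obtain p where "(p, q, a) \<in> transitions A" by (auto simp: strings_snoc transitions_def)
      then show ?thesis by force
    qed
  qed
  moreover have fin: "finite (transitions A)" using set_ts by (metis List.finite_set)
  ultimately have "n \<le> card (insert (init A) ((\<lambda>(u, v, a). v) ` transitions A))"
    by (intro card_mono) auto
  also have "\<dots> \<le> Suc (card ((\<lambda>(u, v, a). v) ` transitions A))" by (rule card_insert_le_m1) auto
  also have "\<dots> \<le> m + 1" using card_image_le[OF fin] m_eq by simp
  finally show ?thesis .
qed

lemma initial_words: "words w (initial_machine (encode A \<nu> \<kappa> ts))"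
proof -
  have "n < 2 ^ w" "m < 2 ^ w" "s < 2 ^ w" "1 < (2::nat) ^ w"
    using limits base_limit s_less by linarith+
  moreover have "\<nu> u < 2 ^ w \<and> \<nu> v < 2 ^ w \<and> \<kappa> a < 2 ^ w" if "(u, v, a) \<in> set ts" for u v a
  proof -
    have "u \<in> states A" "v \<in> states A" "a \<in> alphabet A"
      using that set_ts wf(3) by (auto simp: transitions_def)
    then show ?thesis using \<nu>_less[of u] \<nu>_less[of v] \<kappa>_word \<open>n < 2 ^ w\<close> by auto
  qed
  ultimately have "x < 2 ^ w" if "x \<in> set (encode A \<nu> \<kappa> ts)" for x
    using that by (auto simp: encode_def split: if_splits)
  then show ?thesis by (auto simp: words_def initial_machine_def)
qed

lemma runs_header:
  assumes post: "\<And>t \<rho>. t \<le> 50 \<Longrightarrow> Q t (mk \<rho> (\<lambda>_ _. 0))"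
  shows "runs w header_com (initial_machine (encode A \<nu> \<kappa> ts)) Q"
proof -
  let ?\<sigma> = "initial_machine (encode A \<nu> \<kappa> ts)"
  have mem: "mem ?\<sigma> = inp" by (simp add: inp_def)
  have regs: "regs ?\<sigma> = (\<lambda>_. 0)" by (simp add: initial_machine_def)
  have lay: "lay (\<lambda>_ _. 0) = inp"
  proof
    have "inp a = 0" if "\<not> a < base" for a
      using that by (simp add: inp_def initial_machine_def length_encode base_def)
    then show "lay (\<lambda>_ _. 0) a = inp a" for a by (simp add: lay_def)
  qed
  have mk: "mk (\<lambda>_. 0) (\<lambda>_ _. 0) =
    ?\<sigma>\<lparr>regs := (\<lambda>_. 0)(''n'' := n, ''m'' := m, ''s'' := s, ''B'' := base)\<rparr>"
    unfolding mk_def lay by (simp add: mem[symmetric])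
  have sm: "Suc 0 < 2 ^ w" "2 < (2::nat) ^ w" "3 < (2::nat) ^ w" "3 * m < 2 ^ w" "3 + 3 * m < 2 ^ w"
    "3 + 3 * m + n < 2 ^ w"
    using limits base_limit base_def by linarith+
  show ?thesis unfolding header_com_def
    apply (intro runs_Seq runs_Assign)
        apply (simp_all add: mem regs inp_header inp_header(2)[unfolded One_nat_def] sm)
    using post[of _ "\<lambda>_. 0"] unfolding mk by (simp add: base_def)
qed

lemma runs_partition:
  "runs w partition_com (initial_machine (encode A \<nu> \<kappa> ts))
     (\<lambda>t \<sigma>. t \<le> 5000 * (m * n + 1) \<and> min_chain_partition A (decode A \<nu> \<sigma>))"
  unfolding partition_com_def
proof (rule runs_Seq, rule runs_header, rule runs_Seq, rule runs_adjacency, simp,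
    rule runs_Seq, rule runs_seed, assumption, rule runs_Seq, rule runs_search, assumption,
    assumption, assumption, rule runs_Seq, rule runs_count, assumption, assumption, assumption,
    rule runs_Seq, rule runs_greedy, assumption, assumption, assumption, rule runs_output,
    rule conjI)
  fix F hi k and \<sigma> :: machine
  assume "greedy {..<n} (F 9) hi k" "\<And>v. v < n \<Longrightarrow> mem \<sigma> v = F 9 v"
  then show "min_chain_partition A (decode A \<nu> \<sigma>)" by (rule decode_min_chain_partition)
next
  fix t1 t2 t3 t4 t5 t6 t7 :: nat
  define x y where "x = m * n" and "y = n * n"
  assume "t1 \<le> 50" "t2 \<le> 100 * m + 100" "t3 \<le> 300 * (n * n) + 100"
    "t4 \<le> 800 * (n * n) + 600 * (n * m) + 100" "t5 \<le> 100 * (n * n) + 100"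
    "t6 \<le> 500 * (n * n) + 100" "t7 \<le> 50 * n + 50"
  moreover have "n * n \<le> m * n + n" using mult_le_mono1[OF card_states_le, of n] by simp
  moreover have "m \<le> m * n" using n_pos by simp
  moreover have "n \<le> m * n + 1" using card_states_le calculation(9) by linarith
  ultimately show "t1 + (t2 + (t3 + (t4 + (t5 + (t6 + t7))))) \<le> 5000 * (m * n + 1)"
    unfolding mult.commute[of n m] x_def[symmetric] y_def[symmetric] by simp
qed

end

theorem theorem16:
  "\<exists>P c k. \<forall>(A :: ('q, 'a::linorder) dfa) \<nu> \<kappa> ts w.
     standing_assumptions A \<longrightarrow>
     presentation w A \<nu> \<kappa> ts \<longrightarrow>
     (card (states A) + card (transitions A) + 2) ^ k \<le> (2 :: nat) ^ w \<longrightarrow>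
     (\<exists>t \<sigma>. exec w P (initial_machine (encode A \<nu> \<kappa> ts)) t \<sigma> \<and>
        t \<le> c * (card (transitions A) * card (states A) + 1) \<and>
        min_chain_partition A (decode A \<nu> \<sigma>))"
proof (rule exI[of _ partition_com], rule exI[of _ 5000], rule exI[of _ 7], intro allI impI)
  fix A :: "('q, 'a::linorder) dfa" and \<nu> \<kappa> ts w
  assume "standing_assumptions A" "presentation w A \<nu> \<kappa> ts"
    "(card (states A) + card (transitions A) + 2) ^ 7 \<le> (2 :: nat) ^ w"
  then interpret presented A \<nu> \<kappa> ts w by unfold_locales
  from runs_partition initial_words show "\<exists>t \<sigma>. exec w partition_com (initial_machine (encode A \<nu> \<kappa> ts)) t \<sigma> \<and>
        t \<le> 5000 * (card (transitions A) * card (states A) + 1) \<and>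
        min_chain_partition A (decode A \<nu> \<sigma>)"
    unfolding runs_def m_eq by blast
qed

end
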